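(* Let $G$ be a finite simple graph with vertex set $\{x_1,\dots,x_n\}$ and let $S=\mathbb{K}[x_1,\dots,x_n]$ over a field $\mathbb{K}$. Then: (1) $\operatorname{depth}_S I(G)^2\geq \alpha_2(G)-2$; (2) if $G$ is $W(K_3)$-free, then $\operatorname{depth}_S I(G)^2\geq \alpha_2(G)-1$; (3) if $G$ is triangle-free, then $\operatorname{depth}_S I(G)^2\geq \alpha_2(G)$.
   Context: Vertices of $G$ are identified with the variables of $S$. The edge ideal is $I(G)=(x_ix_j : x_ix_j\in E(G))\subseteq S$. For a homogeneous ideal $I$, $\operatorname{depth}_S I$ denotes the depth of $I$ as an $S$-module. For a vertex $x$, $N_G(x)$ is its set of neighbours and $N_G[x]=N_G(x)\cup\{x\}$. The star with center $x$, $\mathrm{St}(x)$, is the subgraph with vertex set $N_G[x]$ and edges $\{xy: y\in N_G(x)\}$. A star packing of $G$ is a family of stars of $G$ whose vertex sets are pairwise disjoint; the star packing number $\alpha_2(G)$ is the maximum size of a star packing of $G$. A whiskered triangle $W(K_3)$ is the graph obtained from a triangle $K_3$ by attaching a pendant edge (an edge to a new vertex of degree one) at each of its three vertices. $G$ is $H$-free if it has no induced subgraph isomorphic to $H$; triangle-free means $K_3$-free. *)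

theory Defs
  imports Main "HOL-Library.Poly_Mapping" "HOL-Library.Extended_Nat"
begin

type_synonym ('v, 'k) mpoly = "('v \<Rightarrow>\<^sub>0 nat) \<Rightarrow>\<^sub>0 'k"

definition var :: "'v \<Rightarrow> ('v, 'k::field) mpoly" where
  "var v = Poly_Mapping.single (Poly_Mapping.single v 1) 1"

definition gen_ideal :: "('v, 'k::field) mpoly set \<Rightarrow> ('v, 'k) mpoly set" where
  "gen_ideal X = module.span ((*) :: ('v,'k) mpoly \<Rightarrow> _ \<Rightarrow> _) X"

definition ideal_prod :: "('v, 'k::field) mpoly set \<Rightarrow> ('v, 'k) mpoly set \<Rightarrow> ('v, 'k) mpoly set" where
  "ideal_prod I J = gen_ideal {a * b | a b. a \<in> I \<and> b \<in> J}"

text \<open>Homogeneous maximal ideal m = (x_1,...,x_n): polynomials with zero constant term.\<close>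
definition max_ideal :: "('v, 'k::field) mpoly set" where
  "max_ideal = {f. Poly_Mapping.lookup f 0 = 0}"

definition seq_mul :: "('v, 'k::field) mpoly list \<Rightarrow> ('v, 'k) mpoly set \<Rightarrow> ('v, 'k) mpoly set" where
  "seq_mul fs M = gen_ideal {f * g | f g. f \<in> set fs \<and> g \<in> M}"

text \<open>M-regular sequence in the maximal ideal m, M an ideal of S regarded as S-module.\<close>
definition regular_seq :: "('v, 'k::field) mpoly set \<Rightarrow> ('v, 'k) mpoly list \<Rightarrow> bool" where
  "regular_seq M fs \<longleftrightarrow>
     set fs \<subseteq> max_ideal \<and>
     (\<forall>i < length fs. \<forall>g \<in> M. fs ! i * g \<in> seq_mul (take i fs) M \<longrightarrow> g \<in> seq_mul (take i fs) M) \<and>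
     seq_mul fs M \<noteq> M"

text \<open>depth_S M = grade of m on M = supremum of lengths of M-regular sequences in m;
  the zero module has depth \<infinity> by convention.\<close>
definition depth :: "('v, 'k::field) mpoly set \<Rightarrow> enat" where
  "depth M = (if M = {0} then \<infinity> else Sup {enat (length fs) | fs. regular_seq M fs})"

definition edge_ideal :: "('v \<Rightarrow> 'v \<Rightarrow> bool) \<Rightarrow> ('v, 'k::field) mpoly set" where
  "edge_ideal E = gen_ideal {var u * var v | u v. E u v}"

definition simple_graph :: "('v \<Rightarrow> 'v \<Rightarrow> bool) \<Rightarrow> bool" where
  "simple_graph E \<longleftrightarrow> (\<forall>x y. E x y \<longrightarrow> E y x) \<and> (\<forall>x. \<not> E x x)"

definition closed_nbhd :: "('v \<Rightarrow> 'v \<Rightarrow> bool) \<Rightarrow> 'v \<Rightarrow> 'v set" where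
  "closed_nbhd E x = insert x {y. E x y}"

text \<open>A star packing, given by its set of centers: the stars St(x) have pairwise disjoint vertex sets N[x].\<close>
definition star_packing :: "('v \<Rightarrow> 'v \<Rightarrow> bool) \<Rightarrow> 'v set \<Rightarrow> bool" where
  "star_packing E C \<longleftrightarrow>
     (\<forall>x\<in>C. \<forall>y\<in>C. x \<noteq> y \<longrightarrow> closed_nbhd E x \<inter> closed_nbhd E y = {})"

definition star_packing_number :: "('v::finite \<Rightarrow> 'v \<Rightarrow> bool) \<Rightarrow> nat" where
  "star_packing_number E = Max {card C | C. star_packing E C}"

definition has_induced :: "('v \<Rightarrow> 'v \<Rightarrow> bool) \<Rightarrow> nat set \<Rightarrow> (nat \<Rightarrow> nat \<Rightarrow> bool) \<Rightarrow> bool" where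
  "has_induced E VH H \<longleftrightarrow>
     (\<exists>f. inj_on f VH \<and> (\<forall>a\<in>VH. \<forall>b\<in>VH. E (f a) (f b) \<longleftrightarrow> H a b))"

definition K3 :: "nat \<Rightarrow> nat \<Rightarrow> bool" where
  "K3 a b \<longleftrightarrow> a \<noteq> b"

definition WK3 :: "nat \<Rightarrow> nat \<Rightarrow> bool" where
  "WK3 a b \<longleftrightarrow> {a, b} \<in> {{0,1},{1,2},{0,2},{0,3},{1,4},{2,5}}"

definition triangle_free :: "('v \<Rightarrow> 'v \<Rightarrow> bool) \<Rightarrow> bool" where
  "triangle_free E \<longleftrightarrow> \<not> has_induced E {0,1,2} K3"

definition WK3_free :: "('v \<Rightarrow> 'v \<Rightarrow> bool) \<Rightarrow> bool" where
  "WK3_free E \<longleftrightarrow> \<not> has_induced E {0..5} WK3"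

end

theory Submission
  imports Defs
begin

text \<open>
  Let \<open>C\<close> be a maximum star packing, let \<open>l\<^sub>c\<close> be the sum of the variables in the closed
  neighbourhood of \<open>c \<in> C\<close>, and let \<open>e\<^sub>i\<close> be the \<open>i\<close>-th elementary symmetric polynomial of the
  \<open>l\<^sub>c\<close>. Modulo a prime generated by a set of variables that contains at most \<open>k\<close> of the stars, the
  \<open>l\<^sub>c\<close> of the other stars are independent, so \<open>e\<^sub>1, \<dots>, e\<^sub>r\<close> with \<open>r = |C| - k\<close> is a regular
  sequence, over any field. Using symmetric polynomials instead of the \<open>l\<^sub>c\<close> makes
  one sequence work whichever stars are lost.

  Weak regularity on \<open>S/(J : h)\<close> and on \<open>S/(J + (h))\<close> implies weak regularity on \<open>S/J\<close>. Taking for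
  \<open>h\<close> first the edges \<open>ab\<close>, where \<open>I\<^sup>2 : ab = I + N(a)N(b)\<close>, and then suitable vertices, one
  reaches from \<open>S/I\<^sup>2\<close> only primes that contain at most one star, except that keeping a common
  neighbour \<open>u\<close> of \<open>a\<close> and \<open>b\<close> may cost the stars containing \<open>a\<close>, \<open>b\<close> and \<open>u\<close>; these are three
  distinct stars only if they give an induced whiskered triangle. So \<open>k = 3\<close> in general,
  \<open>k = 2\<close> without whiskered triangles and \<open>k = 1\<close> without triangles. Since \<open>e\<^sub>1, \<dots>, e\<^sub>r\<close> is regular on
  \<open>S/I\<^sup>2\<close> and \<open>e\<^sub>1, \<dots>, e\<^sub>r\<^sub>+\<^sub>1\<close> is regular on \<open>S\<close>, the latter sequence is regular on \<open>I\<^sup>2\<close>.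
\<close>

section \<open>Weakly regular sequences modulo an ideal\<close>

definition is_ideal :: "'a::comm_ring_1 set \<Rightarrow> bool" where
  "is_ideal J \<longleftrightarrow> 0 \<in> J \<and> (\<forall>x\<in>J. \<forall>y\<in>J. x + y \<in> J) \<and> (\<forall>a. \<forall>x\<in>J. a * x \<in> J)"

definition adjoin :: "'a::comm_ring_1 \<Rightarrow> 'a set \<Rightarrow> 'a set" where
  "adjoin h J = {a * h + b | a b. b \<in> J}"

definition colon :: "'a::comm_ring_1 set \<Rightarrow> 'a \<Rightarrow> 'a set" where
  "colon J h = {g. h * g \<in> J}"

text \<open>For an ideal \<open>J\<close> this is \<open>J + (f 0, ..., f (i - 1))\<close>, built
  one generator at a time so that membership unfolds into a single new coefficient.\<close>

primrec adjoin_seq :: "(nat \<Rightarrow> 'a::comm_ring_1) \<Rightarrow> nat \<Rightarrow> 'a set \<Rightarrow> 'a set" where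
  "adjoin_seq f 0 J = J"
| "adjoin_seq f (Suc i) J = adjoin (f i) (adjoin_seq f i J)"

text \<open>The last quotient may vanish here; properness is settled separately, by degrees, in
  \<open>depth_mon_ideal_ge\<close>.\<close>

definition weakly_regular :: "(nat \<Rightarrow> 'a::comm_ring_1) \<Rightarrow> nat \<Rightarrow> 'a set \<Rightarrow> bool" where
  "weakly_regular f r J \<longleftrightarrow>
     (\<forall>i<r. \<forall>g. f i * g \<in> adjoin_seq f i J \<longrightarrow> g \<in> adjoin_seq f i J)"

lemma is_ideal_zero: "is_ideal J \<Longrightarrow> 0 \<in> J"
  and is_ideal_add: "is_ideal J \<Longrightarrow> x \<in> J \<Longrightarrow> y \<in> J \<Longrightarrow> x + y \<in> J"
  and is_ideal_mult: "is_ideal J \<Longrightarrow> x \<in> J \<Longrightarrow> a * x \<in> J"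
  by (auto simp: is_ideal_def)

lemma is_ideal_mult_right: "is_ideal J \<Longrightarrow> x \<in> J \<Longrightarrow> x * a \<in> J"
  using is_ideal_mult[of J x a] by (simp add: mult.commute)

lemma is_ideal_diff: "is_ideal J \<Longrightarrow> x \<in> J \<Longrightarrow> y \<in> J \<Longrightarrow> x - y \<in> J"
  using is_ideal_add[of J x "(-1) * y"] is_ideal_mult[of J y "-1"] by simp

lemma is_ideal_sum: "is_ideal J \<Longrightarrow> (\<And>x. x \<in> A \<Longrightarrow> h x \<in> J) \<Longrightarrow> sum h A \<in> J"
  by (induction A rule: infinite_finite_induct) (auto simp: is_ideal_zero is_ideal_add)

lemma is_ideal_zero_ideal: "is_ideal {0}"
  by (auto simp: is_ideal_def)

lemma adjoinI: "b \<in> J \<Longrightarrow> x = a * h + b \<Longrightarrow> x \<in> adjoin h J"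
  by (auto simp: adjoin_def)

lemma is_ideal_adjoin:
  assumes "is_ideal J" shows "is_ideal (adjoin h J)"
  unfolding is_ideal_def
proof (intro conjI ballI allI)
  show "0 \<in> adjoin h J"
    by (rule adjoinI[of 0 _ _ 0]) (use is_ideal_zero[OF assms] in auto)
next
  fix x y assume "x \<in> adjoin h J" "y \<in> adjoin h J"
  then obtain a b a' b' where "b \<in> J" "b' \<in> J" "x = a * h + b" "y = a' * h + b'"
    by (auto simp: adjoin_def)
  then show "x + y \<in> adjoin h J"
    by (intro adjoinI[of "b + b'" _ _ "a + a'"]) (auto simp: is_ideal_add[OF assms] algebra_simps)
next
  fix c x assume "x \<in> adjoin h J"
  then obtain a b where "b \<in> J" "x = a * h + b"
    by (auto simp: adjoin_def)
  then show "c * x \<in> adjoin h J"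
    by (intro adjoinI[of "c * b" _ _ "c * a"]) (auto simp: is_ideal_mult[OF assms] distrib_left mult.assoc)
qed

lemma is_ideal_adjoin_seq: "is_ideal J \<Longrightarrow> is_ideal (adjoin_seq f i J)"
  by (induction i) (auto intro: is_ideal_adjoin)

lemma subset_adjoin: "J \<subseteq> adjoin h J"
  by (auto intro: adjoinI[of _ _ _ 0])

lemma adjoin_mono: "J \<subseteq> J' \<Longrightarrow> adjoin h J \<subseteq> adjoin h J'"
  by (auto simp: adjoin_def)

lemma adjoin_seq_mono: "J \<subseteq> J' \<Longrightarrow> adjoin_seq f i J \<subseteq> adjoin_seq f i J'"
  by (induction i) (auto intro!: adjoin_mono)

lemma subset_adjoin_seq: "J \<subseteq> adjoin_seq f i J"
proof (induction i)
  case (Suc i)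
  then show ?case using subset_adjoin[of "adjoin_seq f i J" "f i"] by auto
qed simp

lemma adjoin_commute: "adjoin h (adjoin k J) = adjoin k (adjoin h J)"
proof -
  have "adjoin h (adjoin k J) \<subseteq> adjoin k (adjoin h J)" for h k
  proof
    fix x assume "x \<in> adjoin h (adjoin k J)"
    then obtain a b c where "c \<in> J" "x = a * h + (b * k + c)"
      by (auto simp: adjoin_def)
    then show "x \<in> adjoin k (adjoin h J)"
      by (intro adjoinI[of "a * h + c" _ _ b] adjoinI[of c _ _ a]) auto
  qed
  then show ?thesis by blast
qed

lemma adjoin_seq_adjoin: "adjoin_seq f i (adjoin h J) = adjoin h (adjoin_seq f i J)"
  by (induction i) (auto simp: adjoin_commute)

lemma weakly_regularD:
  "weakly_regular f r J \<Longrightarrow> i < r \<Longrightarrow> f i * g \<in> adjoin_seq f i J \<Longrightarrow> g \<in> adjoin_seq f i J"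
  by (auto simp: weakly_regular_def)

lemma weakly_regular_le: "weakly_regular f r J \<Longrightarrow> s \<le> r \<Longrightarrow> weakly_regular f s J"
  by (auto simp: weakly_regular_def)

text \<open>Multiplication by \<open>h\<close> from \<open>S/(J : h)\<close> to \<open>S/J\<close>
  stays well defined after reducing by the sequence; \<open>adjoin_seq_colon\<close> is the
  injectivity of the reduced map.\<close>

lemma mult_adjoin_seq_colon:
  "g \<in> adjoin_seq f i (colon J h) \<Longrightarrow> h * g \<in> adjoin_seq f i J"
proof (induction i arbitrary: g)
  case (Suc i)
  then obtain a b where "b \<in> adjoin_seq f i (colon J h)" "g = a * f i + b"
    by (auto simp: adjoin_def)
  with Suc.IH show ?case
    by (auto intro!: adjoinI[of "h * b" _ _ "h * a"] simp: algebra_simps)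
qed (simp add: colon_def)

text \<open>This is the vanishing of a Tor: a sequence that is regular modulo \<open>J + (h)\<close> stays exact on
  the inclusion of \<open>S/(J : h)\<close> into \<open>S/J\<close>.\<close>
lemma adjoin_seq_colon:
  assumes J: "is_ideal J"
  shows "weakly_regular f i (adjoin h J) \<Longrightarrow> h * g \<in> adjoin_seq f i J
    \<Longrightarrow> g \<in> adjoin_seq f i (colon J h)"
proof (induction i arbitrary: g)
  case (Suc i)
  let ?N = "adjoin_seq f i J"
  note N = is_ideal_adjoin_seq[OF J, of f i]
  from Suc.prems(2) obtain a b where b: "b \<in> ?N" and g: "h * g = a * f i + b"
    by (auto simp: adjoin_def)
  \<comment> \<open>As \<open>f i * a = h * g - b\<close>, regularity modulo \<open>h\<close>
    rewrites \<open>a\<close> as \<open>c * h + d\<close>; then \<open>h * (g - c * f i)\<close>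
    lies one level lower and the induction applies.\<close>
  have "f i * a \<in> adjoin h ?N"
    by (rule adjoinI[of "-b" _ _ g]) (use b g is_ideal_diff[OF N is_ideal_zero[OF N] b] in
      \<open>auto simp: algebra_simps\<close>)
  then have "a \<in> adjoin h ?N"
    using weakly_regularD[OF Suc.prems(1), of i a] by (simp add: adjoin_seq_adjoin)
  then obtain c d where d: "d \<in> ?N" and a: "a = c * h + d"
    by (auto simp: adjoin_def)
  have "h * (g - c * f i) = f i * d + b"
    using g a by (simp add: algebra_simps)
  moreover have "f i * d + b \<in> ?N"
    by (intro is_ideal_add[OF N] is_ideal_mult[OF N] b d)
  ultimately have "g - c * f i \<in> adjoin_seq f i (colon J h)"
    using Suc.IH[OF weakly_regular_le[OF Suc.prems(1)]] by simp
  then show ?case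
    by (auto intro!: adjoinI[of "g - c * f i" _ _ c])
qed (simp add: colon_def)

text \<open>The sequence \<open>0 -> S/(J : h) -> S/J -> S/(J + (h)) -> 0\<close> stays exact modulo
  the earlier elements by \<open>adjoin_seq_colon\<close>, so \<open>f i\<close>, being injective on
  both ends, is injective in the middle.\<close>

lemma weakly_regular_branch:
  assumes J: "is_ideal J"
    and colon: "weakly_regular f r (colon J h)" and adj: "weakly_regular f r (adjoin h J)"
  shows "weakly_regular f r J"
  unfolding weakly_regular_def
proof (intro allI impI)
  fix i g assume i: "i < r" and g: "f i * g \<in> adjoin_seq f i J"
  let ?N = "adjoin_seq f i J"
  note N = is_ideal_adjoin_seq[OF J, of f i]
  have "f i * g \<in> adjoin_seq f i (adjoin h J)"
    using g adjoin_seq_mono[OF subset_adjoin] by blast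
  then have "g \<in> adjoin h ?N"
    using weakly_regularD[OF adj i] by (simp add: adjoin_seq_adjoin)
  then obtain a b where b: "b \<in> ?N" and ab: "g = a * h + b"
    by (auto simp: adjoin_def)
  have "h * (f i * a) = f i * g - f i * b"
    by (simp add: ab algebra_simps)
  also have "\<dots> \<in> ?N"
    by (intro is_ideal_diff[OF N] g is_ideal_mult[OF N] b)
  finally have "f i * a \<in> adjoin_seq f i (colon J h)"
    by (rule adjoin_seq_colon[OF J weakly_regular_le[OF adj less_imp_le[OF i]]])
  then have "a \<in> adjoin_seq f i (colon J h)"
    by (rule weakly_regularD[OF colon i])
  then have "h * a \<in> ?N"
    by (rule mult_adjoin_seq_colon)
  then show "g \<in> ?N"
    unfolding ab by (intro is_ideal_add[OF N] b) (simp add: mult.commute)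
qed

lemma adjoin_seq_decompose:
  assumes "is_ideal J" "x \<in> adjoin_seq f i J"
  shows "\<exists>a b. a \<in> adjoin_seq f i {0} \<and> b \<in> J \<and> x = a + b"
  using assms(2)
proof (induction i arbitrary: x)
  case (Suc i)
  then obtain a b where b: "b \<in> adjoin_seq f i J" and x: "x = a * f i + b"
    by (auto simp: adjoin_def)
  with Suc.IH obtain c d where "c \<in> adjoin_seq f i {0}" "d \<in> J" "b = c + d" by blast
  then show ?case using x
    by (intro exI[of _ "a * f i + c"] exI[of _ d]) (auto intro: adjoinI)
qed auto

section \<open>Monomial ideals and the grading\<close>

text \<open>Monomial ideals are handled through their exponent sets, so that colons and sums by
  monomials become operations on sets.\<close>

definition mon_ideal :: "('v \<Rightarrow>\<^sub>0 nat) set \<Rightarrow> ('v, 'k::field) mpoly set" where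
  "mon_ideal U = {f. Poly_Mapping.keys f \<subseteq> U}"

definition upset :: "('v \<Rightarrow>\<^sub>0 nat) set \<Rightarrow> bool" where
  "upset U \<longleftrightarrow> (\<forall>a b. b \<in> U \<longrightarrow> a + b \<in> U)"

lemma poly_as_sum: "(f :: ('v, 'k::field) mpoly) = (\<Sum>k\<in>Poly_Mapping.keys f. Poly_Mapping.single k (Poly_Mapping.lookup f k))"
proof (rule poly_mapping_eqI)
  fix k
  show "Poly_Mapping.lookup f k = Poly_Mapping.lookup (\<Sum>k\<in>Poly_Mapping.keys f. Poly_Mapping.single k (Poly_Mapping.lookup f k)) k"
    by (simp add: lookup_sum lookup_single when_def in_keys_iff)
qed

lemma is_ideal_monomialwise:
  assumes "is_ideal J" "\<And>k c. k \<in> Poly_Mapping.keys f \<Longrightarrow> Poly_Mapping.single k c \<in> J"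
  shows "(f :: ('v, 'k::field) mpoly) \<in> J"
  by (subst poly_as_sum) (auto intro: is_ideal_sum assms)

lemma is_ideal_mon_ideal:
  assumes "upset U" shows "is_ideal (mon_ideal U :: ('v, 'k::field) mpoly set)"
  unfolding is_ideal_def mon_ideal_def
proof (intro conjI ballI allI CollectI)
  fix x y :: "('v, 'k) mpoly" assume "x \<in> {f. Poly_Mapping.keys f \<subseteq> U}" "y \<in> {f. Poly_Mapping.keys f \<subseteq> U}"
  then show "Poly_Mapping.keys (x + y) \<subseteq> U" using Poly_Mapping.keys_add[of x y] by auto
next
  fix a x :: "('v, 'k) mpoly" assume "x \<in> {f. Poly_Mapping.keys f \<subseteq> U}"
  then show "Poly_Mapping.keys (a * x) \<subseteq> U"
    using keys_mult[of a x] assms by (fastforce simp: upset_def)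
qed auto

lemma lookup_monomial_mult:
  "Poly_Mapping.lookup (Poly_Mapping.single a (1::'k::field) * f) (a + b) = Poly_Mapping.lookup f (b::'v \<Rightarrow>\<^sub>0 nat)"
proof -
  have "Poly_Mapping.single a 1 * f
      = (\<Sum>k\<in>Poly_Mapping.keys f. Poly_Mapping.single (a + k) (Poly_Mapping.lookup f k))"
    by (subst (1) poly_as_sum) (simp add: sum_distrib_left mult_single)
  then show ?thesis
    by (simp add: lookup_sum lookup_single when_def in_keys_iff)
qed

text \<open>Multiplying by a monomial translates the exponents injectively, so no terms
  cancel.\<close>

lemma colon_mon_ideal:
  "colon (mon_ideal U :: ('v, 'k::field) mpoly set) (Poly_Mapping.single a 1) = mon_ideal {b. a + b \<in> U}"
proof -
  have "Poly_Mapping.keys (Poly_Mapping.single a 1 * f) = (+) a ` Poly_Mapping.keys f" for f :: "('v, 'k) mpoly"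
  proof
    show "Poly_Mapping.keys (Poly_Mapping.single a 1 * f) \<subseteq> (+) a ` Poly_Mapping.keys f"
      using keys_mult[of "Poly_Mapping.single a 1" f] by auto
    show "(+) a ` Poly_Mapping.keys f \<subseteq> Poly_Mapping.keys (Poly_Mapping.single a 1 * f)"
      by (auto simp: in_keys_iff lookup_monomial_mult)
  qed
  then show ?thesis by (auto simp: colon_def mon_ideal_def)
qed

lemma single_in_mon_ideal: "k \<in> U \<Longrightarrow> Poly_Mapping.single k c \<in> mon_ideal U"
  by (auto simp: mon_ideal_def)

lemma adjoin_mon_ideal:
  assumes "upset U"
  shows "adjoin (Poly_Mapping.single a 1) (mon_ideal U :: ('v, 'k::field) mpoly set)
    = mon_ideal (U \<union> range ((+) a))"
proof
  have U': "upset (U \<union> range ((+) a))"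
    unfolding upset_def
  proof (intro allI impI)
    fix c b assume "b \<in> U \<union> range ((+) a)"
    then consider "b \<in> U" | d where "b = a + d" by auto
    then show "c + b \<in> U \<union> range ((+) a)"
    proof cases
      case 1 then show ?thesis using assms by (auto simp: upset_def)
    next
      case 2
      then have "c + b = a + (c + d)" by (simp add: ac_simps)
      then show ?thesis by blast
    qed
  qed
  note I' = is_ideal_mon_ideal[OF U', where 'k = 'k]
  show "adjoin (Poly_Mapping.single a 1) (mon_ideal U :: ('v, 'k) mpoly set)
    \<subseteq> mon_ideal (U \<union> range ((+) a))"
  proof
    fix x :: "('v, 'k) mpoly" assume "x \<in> adjoin (Poly_Mapping.single a 1) (mon_ideal U)"
    then obtain c b where x: "b \<in> mon_ideal U" "x = c * Poly_Mapping.single a 1 + b"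
      by (auto simp: adjoin_def)
    have "a = a + 0" by simp
    then have "a \<in> range ((+) a)" by blast
    then show "x \<in> mon_ideal (U \<union> range ((+) a))"
      unfolding x(2) using x(1)
      by (intro is_ideal_add[OF I'] is_ideal_mult[OF I'] single_in_mon_ideal) (auto simp: mon_ideal_def)
  qed
  have I: "is_ideal (adjoin (Poly_Mapping.single a 1) (mon_ideal U :: ('v, 'k) mpoly set))"
    by (intro is_ideal_adjoin is_ideal_mon_ideal assms)
  show "mon_ideal (U \<union> range ((+) a)) \<subseteq> adjoin (Poly_Mapping.single a 1) (mon_ideal U :: ('v, 'k) mpoly set)"
  proof
    fix x :: "('v, 'k) mpoly" assume x: "x \<in> mon_ideal (U \<union> range ((+) a))"
    show "x \<in> adjoin (Poly_Mapping.single a 1) (mon_ideal U)"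
    proof (rule is_ideal_monomialwise[OF I])
      fix k and c :: 'k assume "k \<in> Poly_Mapping.keys x"
      then consider "k \<in> U" | d where "k = a + d" using x by (auto simp: mon_ideal_def)
      then show "Poly_Mapping.single k c \<in> adjoin (Poly_Mapping.single a 1) (mon_ideal U)"
      proof cases
        case 1
        then show ?thesis using subset_adjoin single_in_mon_ideal by blast
      next
        case 2
        then show ?thesis
          by (intro adjoinI[of 0 _ _ "Poly_Mapping.single d c"])
            (auto simp: mon_ideal_def mult_single add.commute)
      qed
    qed
  qed
qed

section \<open>The standard grading and homogeneous components\<close>

definition mdeg :: "('v::finite \<Rightarrow>\<^sub>0 nat) \<Rightarrow> nat" where
  "mdeg k = (\<Sum>v\<in>UNIV. Poly_Mapping.lookup k v)"

definition hcomp :: "nat \<Rightarrow> ('v::finite, 'k::field) mpoly \<Rightarrow> ('v, 'k) mpoly" where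
  "hcomp d f = (\<Sum>k\<in>{k \<in> Poly_Mapping.keys f. mdeg k = d}. Poly_Mapping.single k (Poly_Mapping.lookup f k))"

text \<open>Zero is homogeneous of every degree; this covers the symmetric polynomials of degree
  above the number of blocks.\<close>

definition homogeneous :: "nat \<Rightarrow> ('v::finite, 'k::field) mpoly \<Rightarrow> bool" where
  "homogeneous e f \<longleftrightarrow> (\<forall>k\<in>Poly_Mapping.keys f. mdeg k = e)"

definition graded :: "('v::finite, 'k::field) mpoly set \<Rightarrow> bool" where
  "graded J \<longleftrightarrow> (\<forall>f\<in>J. \<forall>d. hcomp d f \<in> J)"

lemma mdeg_add: "mdeg (a + b) = mdeg a + mdeg b"
  by (simp add: mdeg_def lookup_add sum.distrib)

lemma mdeg_zero: "mdeg 0 = 0"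
  by (simp add: mdeg_def)

lemma mdeg_single: "mdeg (Poly_Mapping.single v n) = n"
  by (simp add: mdeg_def lookup_single when_def)

lemma lookup_hcomp: "Poly_Mapping.lookup (hcomp d f) k = (if mdeg k = d then Poly_Mapping.lookup f k else 0)"
  by (simp add: hcomp_def lookup_sum lookup_single when_def in_keys_iff)

lemma hcomp_add: "hcomp d (f + g) = hcomp d f + hcomp d g"
  by (rule poly_mapping_eqI) (simp add: lookup_hcomp lookup_add)

lemma hcomp_zero: "hcomp d 0 = 0"
  by (rule poly_mapping_eqI) (simp add: lookup_hcomp)

lemma hcomp_sum: "hcomp d (sum h A) = (\<Sum>x\<in>A. hcomp d (h x))"
  by (induction A rule: infinite_finite_induct) (auto simp: hcomp_add hcomp_zero)

lemma hcomp_single: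
  "hcomp d (Poly_Mapping.single k c) = (if mdeg k = d then Poly_Mapping.single k c else 0)"
  by (rule poly_mapping_eqI) (auto simp: lookup_hcomp lookup_single when_def)

lemma hcomp_mult:
  assumes "homogeneous e f"
  shows "hcomp d (f * g) = (if e \<le> d then f * hcomp (d - e) g else 0)"
proof -
  let ?s = "\<lambda>f k. Poly_Mapping.single k (Poly_Mapping.lookup f k)"
  have *: "hcomp d (?s f a * ?s g b) = (if e \<le> d then ?s f a * hcomp (d - e) (?s g b) else 0)"
    if "a \<in> Poly_Mapping.keys f" for a b
    using that assms by (auto simp: homogeneous_def mult_single hcomp_single mdeg_add)
  have "hcomp d (f * g) = hcomp d ((\<Sum>a\<in>Poly_Mapping.keys f. ?s f a) * (\<Sum>b\<in>Poly_Mapping.keys g. ?s g b))"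
    by (simp flip: poly_as_sum)
  also have "\<dots> = (\<Sum>a\<in>Poly_Mapping.keys f. \<Sum>b\<in>Poly_Mapping.keys g. hcomp d (?s f a * ?s g b))"
    by (simp add: sum_product hcomp_sum)
  also have "\<dots> = (\<Sum>a\<in>Poly_Mapping.keys f. \<Sum>b\<in>Poly_Mapping.keys g. if e \<le> d then ?s f a * hcomp (d - e) (?s g b) else 0)"
    by (intro sum.cong refl *)
  also have "\<dots> = (if e \<le> d then (\<Sum>a\<in>Poly_Mapping.keys f. ?s f a) * hcomp (d - e) (\<Sum>b\<in>Poly_Mapping.keys g. ?s g b) else 0)"
    by (simp add: sum_product hcomp_sum)
  finally show ?thesis by (simp flip: poly_as_sum)
qed

lemma is_ideal_hcomp:
  assumes "is_ideal J" "\<And>d. hcomp d f \<in> J" shows "f \<in> J"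
proof -
  have *: "f = (\<Sum>d\<in>mdeg ` Poly_Mapping.keys f. hcomp d f)"
    by (rule poly_mapping_eqI) (auto simp: lookup_sum lookup_hcomp in_keys_iff sum.delta)
  show ?thesis by (subst *) (intro is_ideal_sum assms)
qed

lemma graded_adjoin:
  assumes J: "is_ideal J" "graded J" and h: "homogeneous e h"
  shows "graded (adjoin h J)"
  unfolding graded_def
proof (intro ballI allI)
  fix x d assume "x \<in> adjoin h J"
  then obtain a b where b: "b \<in> J" and x: "x = h * a + b"
    by (auto simp: adjoin_def mult.commute)
  have "hcomp d b \<in> J" using J b unfolding graded_def by blast
  then show "hcomp d x \<in> adjoin h J"
    unfolding x hcomp_add hcomp_mult[OF h]
    by (intro adjoinI[of "hcomp d b" _ _ "if e \<le> d then hcomp (d - e) a else 0"])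
      (auto simp: mult.commute)
qed

lemma graded_adjoin_seq:
  assumes "is_ideal J" "graded J" and "\<And>i. homogeneous (e i) (f i)"
  shows "graded (adjoin_seq f i J)"
  by (induction i) (auto intro: graded_adjoin is_ideal_adjoin_seq assms)

lemma keys_hcomp: "Poly_Mapping.keys (hcomp d f) \<subseteq> Poly_Mapping.keys f"
  by (intro subsetI) (simp add: in_keys_iff lookup_hcomp split: if_splits)

lemma graded_mon_ideal: "graded (mon_ideal U)"
  unfolding graded_def mon_ideal_def using keys_hcomp by blast

text \<open>Here \<open>h\<close> is a nonzerodivisor modulo \<open>J\<close> and \<open>f\<close>
  is regular modulo \<open>J + (h)\<close>. The grading plays the part of Nakayama's lemma: an
  element killed by \<open>f i\<close> is a multiple of \<open>h\<close> up to \<open>?N\<close>,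
  and induction on the degree applies to the cofactor.\<close>

lemma weakly_regular_lift:
  assumes J: "is_ideal J" "graded J" and f: "\<And>i. homogeneous (e i) (f i)"
    and h: "homogeneous 1 h" "colon J h = J" and adj: "weakly_regular f r (adjoin h J)"
  shows "weakly_regular f r J"
  unfolding weakly_regular_def
proof (intro allI impI)
  fix i g assume i: "i < r" and g: "f i * g \<in> adjoin_seq f i J"
  let ?N = "adjoin_seq f i J"
  note N = is_ideal_adjoin_seq[OF J(1), of f i]
  note gN = graded_adjoin_seq[where e = e and f = f and i = i, OF J f]
  have "hcomp d g \<in> ?N" if "f i * g \<in> ?N" for d g
    using that
  proof (induction d arbitrary: g rule: less_induct)
    case (less d g)
    note g = less.prems
    have IH: "hcomp (d - 1) a \<in> ?N" if "d \<noteq> 0" "f i * a \<in> ?N" for a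
      using less.IH[of "d - 1" a] that by auto
    from g have "f i * g \<in> adjoin_seq f i (adjoin h J)"
      using adjoin_seq_mono[OF subset_adjoin] by blast
    then have "g \<in> adjoin h ?N"
      using weakly_regularD[OF adj i] by (simp add: adjoin_seq_adjoin)
    then obtain a b where b: "b \<in> ?N" and ab: "g = h * a + b"
      by (auto simp: adjoin_def mult.commute)
    have "h * (f i * a) = f i * g - f i * b"
      by (simp add: ab algebra_simps)
    also have "\<dots> \<in> ?N"
      by (intro is_ideal_diff[OF N] g is_ideal_mult[OF N] b)
    \<comment> \<open>As \<open>colon J h = J\<close>, the cofactor \<open>a\<close> satisfies the
      same hypothesis as \<open>g\<close>, and since \<open>h\<close> is linear only its component
      in degree \<open>d - 1\<close> enters.\<close>
    finally have "f i * a \<in> adjoin_seq f i (colon J h)"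
      by (rule adjoin_seq_colon[OF J(1) weakly_regular_le[OF adj less_imp_le[OF i]]])
    then have a: "f i * a \<in> ?N" by (simp add: h)
    have b': "hcomp d b \<in> ?N" using gN b unfolding graded_def by blast
    show "hcomp d g \<in> ?N"
    proof (cases "d = 0")
      case True
      then have "hcomp d g = hcomp d b" by (simp add: ab hcomp_add hcomp_mult[OF h(1)])
      then show ?thesis using b' by simp
    next
      case False
      then have "hcomp d g = h * hcomp (d - 1) a + hcomp d b"
        by (simp add: ab hcomp_add hcomp_mult[OF h(1)])
      then show ?thesis
        using is_ideal_add[OF N is_ideal_mult[OF N IH[OF False a]] b'] by simp
    qed
  qed
  from this[OF g] show "g \<in> ?N" by (rule is_ideal_hcomp[OF N])
qed

section \<open>Primes generated by variables\<close>

definition prime_up :: "'v set \<Rightarrow> ('v \<Rightarrow>\<^sub>0 nat) set" where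
  "prime_up Z = {b. \<exists>z\<in>Z. 0 < Poly_Mapping.lookup b z}"

lemma upset_prime_up: "upset (prime_up Z)"
  by (auto simp: upset_def prime_up_def lookup_add)

text \<open>A variable outside a prime generated by variables is a nonzerodivisor modulo it.\<close>

lemma colon_prime_up:
  "v \<notin> Z \<Longrightarrow> {b. Poly_Mapping.single v 1 + b \<in> prime_up Z} = prime_up Z"
  by (auto simp: prime_up_def lookup_add lookup_single when_def)

lemma range_add_single: "range ((+) (Poly_Mapping.single v (1::nat))) = prime_up {v}"
proof
  show "prime_up {v} \<subseteq> range ((+) (Poly_Mapping.single v 1))"
  proof
    fix b :: "'a \<Rightarrow>\<^sub>0 nat" assume "b \<in> prime_up {v}"
    then have "b = Poly_Mapping.single v 1 + (b - Poly_Mapping.single v 1)"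
      by (intro poly_mapping_eqI) (auto simp: prime_up_def lookup_add lookup_minus lookup_single when_def)
    then show "b \<in> range ((+) (Poly_Mapping.single v 1))" by blast
  qed
qed (auto simp: prime_up_def lookup_add)

lemma prime_up_insert: "prime_up Z \<union> prime_up {v} = prime_up (insert v Z)"
  by (auto simp: prime_up_def)

lemma weakly_regular_mon_branch:
  fixes f :: "nat \<Rightarrow> ('v, 'k::field) mpoly"
  assumes "upset U" "weakly_regular f r (mon_ideal {b. a + b \<in> U})"
    and "weakly_regular f r (mon_ideal (U \<union> range ((+) a)))"
  shows "weakly_regular f r (mon_ideal U)"
  by (rule weakly_regular_branch[where h = "Poly_Mapping.single a 1"])
    (use assms in \<open>simp_all add: is_ideal_mon_ideal colon_mon_ideal adjoin_mon_ideal\<close>)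

lemma homogeneous_var: "homogeneous 1 (var v)"
  by (simp add: homogeneous_def var_def mdeg_single)

lemma homogeneous_one: "homogeneous 0 1"
  by (simp add: homogeneous_def mdeg_zero)

lemma homogeneous_mult: "homogeneous d f \<Longrightarrow> homogeneous e g \<Longrightarrow> homogeneous (d + e) (f * g)"
  using keys_mult[of f g] by (fastforce simp: homogeneous_def mdeg_add)

lemma homogeneous_sum: "(\<And>x. x \<in> A \<Longrightarrow> homogeneous d (h x)) \<Longrightarrow> homogeneous d (sum h A)"
  using keys_sum[of h A] by (fastforce simp: homogeneous_def)

lemma homogeneous_prod:
  "finite A \<Longrightarrow> (\<And>x. x \<in> A \<Longrightarrow> homogeneous 1 (h x)) \<Longrightarrow> homogeneous (card A) (prod h A)"
proof (induction A rule: finite_induct)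
  case (insert x A)
  then show ?case using homogeneous_mult[of 1 "h x" "card A" "prod h A"] by simp
qed (simp add: homogeneous_one)

section \<open>Elementary symmetric polynomials in sums of variables over blocks\<close>

definition block_sum :: "'v set \<Rightarrow> ('v, 'k::field) mpoly" where
  "block_sum A = (\<Sum>v\<in>A. var v)"

text \<open>For finite \<open>C\<close>, index \<open>0\<close> gives the constant \<open>1\<close>,
  which is why the sequences below use the index \<open>Suc i\<close>.\<close>

definition block_esym :: "('c \<Rightarrow> 'v set) \<Rightarrow> 'c set \<Rightarrow> nat \<Rightarrow> ('v, 'k::field) mpoly" where
  "block_esym B C i = (\<Sum>D\<in>{D. D \<subseteq> C \<and> card D = i}. \<Prod>c\<in>D. block_sum (B c))"

lemma homogeneous_block_esym:
  assumes "finite C" shows "homogeneous i (block_esym B C i :: ('v::finite, 'k::field) mpoly)"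
  unfolding block_esym_def
proof (rule homogeneous_sum)
  fix D assume D: "D \<in> {D. D \<subseteq> C \<and> card D = i}"
  then have "homogeneous (card D) (\<Prod>c\<in>D. block_sum (B c) :: ('v, 'k) mpoly)"
    by (intro homogeneous_prod finite_subset[OF _ assms])
      (auto simp: block_sum_def simp del: One_nat_def intro!: homogeneous_sum homogeneous_var)
  then show "homogeneous i (\<Prod>c\<in>D. block_sum (B c) :: ('v, 'k) mpoly)" using D by simp
qed

lemma var_in_prime: "v \<in> Z \<Longrightarrow> var v \<in> mon_ideal (prime_up Z)"
  unfolding var_def by (rule single_in_mon_ideal) (auto simp: prime_up_def intro!: bexI[of _ v])

text \<open>Any other index set of the same size as \<open>A\<close> is not contained in
  \<open>A\<close>, so its product has a factor in \<open>J\<close>.\<close>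

lemma block_esym_cong_prod:
  fixes B :: "'c \<Rightarrow> 'v set"
  assumes "finite C" and A: "A \<subseteq> C" and J: "is_ideal J"
    and 0: "\<And>c. c \<in> C - A \<Longrightarrow> block_sum (B c) \<in> J"
  shows "(block_esym B C (card A) :: ('v, 'k::field) mpoly) - (\<Prod>c\<in>A. block_sum (B c)) \<in> J"
proof -
  let ?T = "{D. D \<subseteq> C \<and> card D = card A}"
  let ?p = "\<lambda>D. \<Prod>c\<in>D. block_sum (B c) :: ('v, 'k) mpoly"
  have fin: "finite ?T" using assms(1) by simp
  have "block_esym B C (card A) = ?p A + sum ?p (?T - {A})"
    unfolding block_esym_def using fin A by (subst sum.remove[of _ A]) auto
  moreover have "sum ?p (?T - {A}) \<in> J"
  proof (rule is_ideal_sum[OF J])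
    fix D assume D: "D \<in> ?T - {A}"
    have finD: "finite D" using D assms(1) finite_subset by auto
    have "\<not> D \<subseteq> A"
      using D A card_subset_eq[of A D] finite_subset[OF A assms(1)] by auto
    then obtain c where c: "c \<in> D" "c \<notin> A" by blast
    then have "?p D = block_sum (B c) * ?p (D - {c})"
      using finD by (simp add: prod.remove)
    moreover have "block_sum (B c) \<in> J" using 0 c D by auto
    ultimately show "?p D \<in> J" by (simp add: is_ideal_mult_right[OF J])
  qed
  ultimately show ?thesis by simp
qed

lemma is_ideal_cancel_prod:
  assumes "finite A" "\<And>c g. c \<in> A \<Longrightarrow> h c * g \<in> J \<Longrightarrow> g \<in> J" "prod h A * g \<in> J"
  shows "g \<in> J"
  using assms
proof (induction A arbitrary: g rule: finite_induct)
  case (insert c A)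
  have "prod h A * g \<in> J"
    using insert.prems(1)[of c "prod h A * g"] insert.prems(2) insert.hyps by (simp add: mult.assoc)
  then show ?case using insert.IH insert.prems(1) by blast
qed simp

text \<open>Adding a variable outside \<open>Z\<close> to \<open>Z\<close> is harmless while \<open>r\<close> blocks survive. Once this is
  impossible, each of exactly \<open>r\<close> surviving blocks has a single surviving variable, and the last
  symmetric polynomial is congruent to the product of these variables.\<close>
lemma weakly_regular_prime:
  fixes B :: "'c \<Rightarrow> 'v::finite set"
  assumes C: "finite C" and disj: "\<And>c d. c \<in> C \<Longrightarrow> d \<in> C \<Longrightarrow> c \<noteq> d \<Longrightarrow> B c \<inter> B d = {}"
  shows "r \<le> card {c \<in> C. \<not> B c \<subseteq> Z} \<Longrightarrow>
    weakly_regular (\<lambda>i. block_esym B C (Suc i) :: ('v, 'k::field) mpoly) r (mon_ideal (prime_up Z))"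
\<comment> \<open>The measure drops both when a variable joins \<open>Z\<close> and when the
  sequence is shortened.\<close>
proof (induction "r + card (- Z)" arbitrary: r Z rule: less_induct)
  case less
  let ?f = "\<lambda>i. block_esym B C (Suc i) :: ('v, 'k) mpoly"
  let ?J = "mon_ideal (prime_up Z) :: ('v, 'k) mpoly set"
  let ?S = "\<lambda>Z. {c \<in> C. \<not> B c \<subseteq> Z}"
  have finS: "finite (?S Z)" for Z using C by simp
  have J: "is_ideal ?J" by (intro is_ideal_mon_ideal upset_prime_up)
  have adj: "adjoin (var v) ?J = mon_ideal (prime_up (insert v Z))" for v
    unfolding var_def by (simp add: adjoin_mon_ideal upset_prime_up range_add_single prime_up_insert
      del: One_nat_def)
  have colon: "colon ?J (var v) = ?J" if "v \<notin> Z" for v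
    unfolding var_def using that colon_prime_up[OF that] by (simp add: colon_mon_ideal)
  have smaller: "card (- insert v Z) < card (- Z)" if "v \<notin> Z" for v
    using that by (intro psubset_card_mono) auto
  show ?case
  proof (cases "\<exists>v. v \<notin> Z \<and> r \<le> card (?S (insert v Z))")
    case True
    then obtain v where v: "v \<notin> Z" "r \<le> card (?S (insert v Z))" by blast
    have "weakly_regular ?f r (adjoin (var v) ?J)"
      unfolding adj using smaller[OF v(1)] v(2) by (intro less.hyps) auto
    then show ?thesis
      by (rule weakly_regular_lift[where h = "var v" and e = Suc, OF J graded_mon_ideal
          homogeneous_block_esym[OF C] homogeneous_var colon[OF v(1)]])
  next
    case False
    show ?thesis
    proof (cases r)
      case 0
      then show ?thesis by (simp add: weakly_regular_def)
    next
      case (Suc s)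
      \<comment> \<open>Every variable outside \<open>Z\<close> now costs a block, so it is the last
        surviving variable of that block, and by disjointness no other block is lost with
        it.\<close>
      have single: "\<exists>c\<in>?S Z. B c - Z = {v} \<and> ?S Z - {c} \<subseteq> ?S (insert v Z)" if v: "v \<notin> Z" for v
      proof -
        have "card (?S (insert v Z)) < card (?S Z)"
          using False less.prems v by force
        then have "\<not> ?S Z \<subseteq> ?S (insert v Z)"
          using card_mono[OF finS, of "?S Z" "insert v Z"] by linarith
        then obtain c where c: "c \<in> C" "\<not> B c \<subseteq> Z" "B c \<subseteq> insert v Z" by blast
        then have "B c - Z = {v}" using v by auto
        moreover have "?S Z - {c} \<subseteq> ?S (insert v Z)"
        proof
          fix d assume d: "d \<in> ?S Z - {c}"
          then have "v \<notin> B d" using disj[of c d] c \<open>B c - Z = {v}\<close> by auto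
          then show "d \<in> ?S (insert v Z)" using d by auto
        qed
        ultimately show ?thesis using c by auto
      qed
      have "?S Z \<noteq> {}" using less.prems Suc by (intro notI) simp
      then obtain c0 w where c0: "c0 \<in> ?S Z" "w \<in> B c0" "w \<notin> Z" by blast
      have cS: "s \<le> card (?S (insert v Z))" if v: "v \<notin> Z" for v
      proof -
        obtain c where c: "c \<in> ?S Z" "?S Z - {c} \<subseteq> ?S (insert v Z)" using single[OF v] by blast
        have "card (?S Z) - 1 = card (?S Z - {c})" using c(1) finS by (simp add: card_Diff_singleton)
        also have "\<dots> \<le> card (?S (insert v Z))" by (intro card_mono finS c)
        finally show ?thesis using less.prems Suc by linarith
      qed
      \<comment> \<open>Removing \<open>w\<close> costs only one block yet leaves fewer than
        \<open>r\<close>, so exactly \<open>r\<close> blocks survive.\<close>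
      have r: "card (?S Z) = r"
      proof -
        obtain c where c: "c \<in> ?S Z" "?S Z - {c} \<subseteq> ?S (insert w Z)" using single[OF c0(3)] by blast
        have "card (?S Z) - 1 = card (?S Z - {c})" using c(1) finS by (simp add: card_Diff_singleton)
        also have "\<dots> \<le> card (?S (insert w Z))" by (intro card_mono finS c)
        also have "\<dots> < r" using False c0(3) by auto
        finally show ?thesis using less.prems by linarith
      qed
      let ?N = "adjoin_seq ?f s ?J"
      note N = is_ideal_adjoin_seq[OF J, of ?f s]
      have JN: "?J \<subseteq> ?N" by (rule subset_adjoin_seq)
      \<comment> \<open>Modulo \<open>?J\<close> the block sum is its one surviving variable
        \<open>v\<close>. Since the first \<open>s\<close> elements are regular modulo
        \<open>?J + (var v)\<close> by induction, \<open>adjoin_seq_colon\<close> makes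
        \<open>var v\<close> a nonzerodivisor modulo \<open>?N\<close>.\<close>
      have reg: "g \<in> ?N" if c: "c \<in> ?S Z" and g: "block_sum (B c) * g \<in> ?N" for c g
      proof -
        obtain v where v: "v \<in> B c" "v \<notin> Z" using c by blast
        obtain d where d: "d \<in> ?S Z" "B d - Z = {v}" using single[OF v(2)] by blast
        have "d = c" using disj[of c d] c d v by auto
        then have Bc: "B c - Z = {v}" using d by simp
        have "(block_sum (B c) :: ('v, 'k) mpoly) = var v + (\<Sum>u\<in>B c - {v}. var u)"
          unfolding block_sum_def using v by (subst sum.remove[of _ v]) auto
        then have "(block_sum (B c) :: ('v, 'k) mpoly) - var v = (\<Sum>u\<in>B c - {v}. var u)"
          by simp
        also have "\<dots> \<in> ?J"
          using Bc by (intro is_ideal_sum[OF J] var_in_prime) auto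
        finally have "block_sum (B c) - var v \<in> ?N" using JN by blast
        then have "block_sum (B c) * g - (block_sum (B c) - var v) * g \<in> ?N"
          by (rule is_ideal_diff[OF N g is_ideal_mult_right[OF N]])
        then have "var v * g \<in> ?N" by (simp add: algebra_simps)
        moreover have "weakly_regular ?f s (adjoin (var v) ?J)"
          unfolding adj using smaller[OF v(2)] cS[OF v(2)] Suc by (intro less.hyps) auto
        ultimately have "g \<in> adjoin_seq ?f s (colon ?J (var v))"
          by (intro adjoin_seq_colon[OF J])
        then show ?thesis by (simp add: colon v)
      qed
      have last: "g \<in> ?N" if g: "?f s * g \<in> ?N" for g
      proof -
        \<comment> \<open>\<open>?f s\<close> has degree \<open>Suc s\<close>, which is the number
          of surviving blocks; the other block sums lie in \<open>?J\<close>.\<close>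
        have "block_esym B C (card (?S Z)) - (\<Prod>c\<in>?S Z. block_sum (B c)) \<in> ?J"
          by (intro block_esym_cong_prod C J)
            (auto simp: block_sum_def intro!: is_ideal_sum[OF J] var_in_prime)
        then have "?f s - (\<Prod>c\<in>?S Z. block_sum (B c)) \<in> ?N"
          using JN r Suc by auto
        then have "?f s * g - (?f s - (\<Prod>c\<in>?S Z. block_sum (B c))) * g \<in> ?N"
          by (rule is_ideal_diff[OF N g is_ideal_mult_right[OF N]])
        then have p: "(\<Prod>c\<in>?S Z. block_sum (B c)) * g \<in> ?N" by (simp add: algebra_simps)
        show ?thesis by (rule is_ideal_cancel_prod[OF finS _ p]) (rule reg)
      qed
      have "weakly_regular ?f s ?J"
        using less.prems Suc by (intro less.hyps) auto
      then show ?thesis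
        using last unfolding Suc weakly_regular_def less_Suc_eq by blast
    qed
  qed
qed

section \<open>Edge ideals with deleted vertices\<close>

text \<open>A loop at \<open>u\<close> contributes the generator \<open>u\<^sup>2\<close>; loops arise at the common neighbours of \<open>a\<close> and
  \<open>b\<close> when passing to \<open>I\<^sup>2 : ab\<close>.\<close>
definition edge_up :: "('v \<Rightarrow> 'v \<Rightarrow> bool) \<Rightarrow> ('v \<Rightarrow>\<^sub>0 nat) set" where
  "edge_up R = {b. \<exists>u v. R u v \<and> 0 < Poly_Mapping.lookup b u \<and> 0 < Poly_Mapping.lookup b v
     \<and> (u = v \<longrightarrow> 1 < Poly_Mapping.lookup b u)}"

lemma edge_upI:
  "R u v \<Longrightarrow> 0 < Poly_Mapping.lookup b u \<Longrightarrow> 0 < Poly_Mapping.lookup b v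
    \<Longrightarrow> (u = v \<Longrightarrow> 1 < Poly_Mapping.lookup b u) \<Longrightarrow> b \<in> edge_up R"
  unfolding edge_up_def by blast

lemma upset_edge_up: "upset (edge_up R)"
  unfolding upset_def edge_up_def by (fastforce simp: lookup_add)

lemma upset_Un: "upset U \<Longrightarrow> upset V \<Longrightarrow> upset (U \<union> V)"
  by (auto simp: upset_def)

text \<open>Monomials of edges that meet \<open>Z\<close> already lie in the ideal generated by the
  variables in \<open>Z\<close>.\<close>

lemma edge_up_cong:
  assumes "\<And>u v. u \<notin> Z \<Longrightarrow> v \<notin> Z \<Longrightarrow> R u v \<longleftrightarrow> R' u v"
  shows "edge_up R \<union> prime_up Z = edge_up R' \<union> prime_up Z"
  using assms unfolding edge_up_def prime_up_def by blast

text \<open>Dividing an edge at \<open>v\<close> by \<open>v\<close> leaves the other endpoint; a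
  loop leaves \<open>v\<close> itself, which is again in \<open>{w. R v w}\<close>.\<close>

lemma colon_edge_up:
  assumes sym: "symp R" and v: "v \<notin> Z"
  shows "{b. Poly_Mapping.single v 1 + b \<in> edge_up R \<union> prime_up Z}
    = edge_up R \<union> prime_up (Z \<union> {w. R v w})"
proof (intro equalityI subsetI)
  fix b assume "b \<in> {b. Poly_Mapping.single v 1 + b \<in> edge_up R \<union> prime_up Z}"
  then consider "Poly_Mapping.single v 1 + b \<in> edge_up R" | "Poly_Mapping.single v 1 + b \<in> prime_up Z"
    by auto
  then show "b \<in> edge_up R \<union> prime_up (Z \<union> {w. R v w})"
  proof cases
    case 1
    then obtain u w where *: "R u w" "R w u" "u = v \<or> 0 < Poly_Mapping.lookup b u"
        "w = v \<or> 0 < Poly_Mapping.lookup b w" "u = w \<longrightarrow> (if u = v then 0 else 1) < Poly_Mapping.lookup b u"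
      using sympD[OF sym] by (fastforce simp: edge_up_def lookup_add lookup_single when_def split: if_splits)
    show ?thesis
    proof (cases "u = v \<or> w = v")
      case True
      then have "b \<in> prime_up {w. R v w}" using * by (auto simp: prime_up_def)
      then show ?thesis by (auto simp: prime_up_def)
    next
      case False
      then have "b \<in> edge_up R" using * by (auto simp: edge_up_def)
      then show ?thesis by simp
    qed
  next
    case 2
    then show ?thesis using v by (auto simp: prime_up_def lookup_add lookup_single when_def split: if_splits)
  qed
next
  fix b assume "b \<in> edge_up R \<union> prime_up (Z \<union> {w. R v w})"
  then consider "b \<in> edge_up R \<union> prime_up Z" | w where "R v w" "0 < Poly_Mapping.lookup b w"
    by (auto simp: prime_up_def)
  then show "b \<in> {b. Poly_Mapping.single v 1 + b \<in> edge_up R \<union> prime_up Z}"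
  proof cases
    case 1
    then show ?thesis
      using upset_Un[OF upset_edge_up[of R] upset_prime_up[of Z]] by (auto simp: upset_def)
  next
    case 2
    then have "Poly_Mapping.single v 1 + b \<in> edge_up R"
      by (intro edge_upI[of R v w]) (auto simp: lookup_add lookup_single when_def)
    then show ?thesis by simp
  qed
qed

text \<open>Branching on the variable of \<open>v\<close>: the colon puts the neighbours of
  \<open>v\<close> into \<open>Z\<close>, whereas adjoining puts \<open>v\<close> itself
  there.\<close>

lemma weakly_regular_vertex_branch:
  fixes f :: "nat \<Rightarrow> ('v, 'k::field) mpoly"
  assumes sym: "symp R" and v: "v \<notin> Z"
    and keep: "weakly_regular f r (mon_ideal (edge_up R \<union> prime_up (Z \<union> {w. R v w})))"
    and kill: "weakly_regular f r (mon_ideal (edge_up R \<union> prime_up (insert v Z)))"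
  shows "weakly_regular f r (mon_ideal (edge_up R \<union> prime_up Z))"
proof (rule weakly_regular_mon_branch[where a = "Poly_Mapping.single v 1"])
  show "upset (edge_up R \<union> prime_up Z)" by (intro upset_Un upset_edge_up upset_prime_up)
  show "weakly_regular f r (mon_ideal {b. Poly_Mapping.single v 1 + b \<in> edge_up R \<union> prime_up Z})"
    unfolding colon_edge_up[OF sym v] by (rule keep)
  show "weakly_regular f r (mon_ideal (edge_up R \<union> prime_up Z \<union> range ((+) (Poly_Mapping.single v 1))))"
    unfolding range_add_single Un_assoc prime_up_insert by (rule kill)
qed

text \<open>A star is safe if it keeps a variable in every prime reached by branching on vertices that
  are not centers: either its center is still present, or it contains a vertex that can no longer
  be removed because all neighbours are gone.\<close>
definition safe :: "('v \<Rightarrow> 'v \<Rightarrow> bool) \<Rightarrow> 'v set \<Rightarrow> 'v \<Rightarrow> bool" where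
  "safe E Z c \<longleftrightarrow> c \<notin> Z \<or> (\<exists>v\<in>closed_nbhd E c - Z. {w. E v w} \<subseteq> Z)"

lemma star_packing_eq:
  assumes "star_packing E C" "c \<in> C" "d \<in> C" "v \<in> closed_nbhd E c" "v \<in> closed_nbhd E d"
  shows "c = d"
  using assms unfolding star_packing_def by blast

text \<open>Branching on non-centers that still have a neighbour outside \<open>Z\<close> enlarges
  \<open>Z\<close> and preserves safety. When none is left no edge survives, the ideal is a prime
  generated by variables, and safe stars are not contained in \<open>Z\<close>.\<close>

lemma weakly_regular_safe:
  fixes f :: "nat \<Rightarrow> ('v::finite, 'k::field) mpoly"
  assumes E: "simple_graph E" and C: "star_packing E C"
    and prime: "\<And>Z. r \<le> card {c \<in> C. \<not> closed_nbhd E c \<subseteq> Z} \<Longrightarrow>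
      weakly_regular f r (mon_ideal (prime_up Z))"
  shows "r \<le> card {c \<in> C. safe E Z c} \<Longrightarrow>
    weakly_regular f r (mon_ideal (edge_up E \<union> prime_up Z))"
proof (induction "card (- Z)" arbitrary: Z rule: less_induct)
  case less
  have sym: "\<And>x y. E x y \<Longrightarrow> E y x" and irr: "\<And>x. \<not> E x x"
    using E by (auto simp: simple_graph_def)
  have symE: "symp E" using sym by (auto intro: sympI)
  show ?case
  proof (cases "\<exists>v. v \<notin> Z \<and> v \<notin> C \<and> \<not> {w. E v w} \<subseteq> Z")
    case True
    then obtain v where v: "v \<notin> Z" "v \<notin> C" "\<not> {w. E v w} \<subseteq> Z" by blast
    \<comment> \<open>If the center \<open>c\<close> is removed as a neighbour of \<open>v\<close>,
      then \<open>v\<close> is the new witness in its star. An old witness is not adjacent to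
      \<open>v\<close>, since its neighbours lie in \<open>Z\<close> and \<open>v\<close> does
      not.\<close>
    have keep: "safe E (Z \<union> {w. E v w}) c" if "c \<in> C" "safe E Z c" for c
      using that v sym irr unfolding safe_def closed_nbhd_def by blast
    \<comment> \<open>\<open>v\<close> is neither a center nor a witness, because it still has a
      neighbour outside \<open>Z\<close>.\<close>
    have kill: "safe E (insert v Z) c" if "c \<in> C" "safe E Z c" for c
      using that v sym irr unfolding safe_def closed_nbhd_def by blast
    show ?thesis
    proof (rule weakly_regular_vertex_branch[OF symE v(1)])
      show "weakly_regular f r (mon_ideal (edge_up E \<union> prime_up (Z \<union> {w. E v w})))"
      proof (rule less.hyps)
        show "card (- (Z \<union> {w. E v w})) < card (- Z)"
          using v(3) by (intro psubset_card_mono) auto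
        show "r \<le> card {c \<in> C. safe E (Z \<union> {w. E v w}) c}"
          using less.prems by (rule order_trans) (intro card_mono, use keep in auto)
      qed
      show "weakly_regular f r (mon_ideal (edge_up E \<union> prime_up (insert v Z)))"
      proof (rule less.hyps)
        show "card (- insert v Z) < card (- Z)"
          using v(1) by (intro psubset_card_mono) auto
        show "r \<le> card {c \<in> C. safe E (insert v Z) c}"
          using less.prems by (rule order_trans) (intro card_mono, use kill in auto)
      qed
    qed
  next
    case False
    \<comment> \<open>A surviving edge would join two centers, which the packing forbids.\<close>
    have "\<not> E u v" if "u \<notin> Z" "v \<notin> Z" for u v
    proof
      assume uv: "E u v"
      then have "u \<in> C" "v \<in> C" using False that sym by blast+
      then have "u = v" by (rule star_packing_eq[OF C, of _ _ u]) (use uv sym in \<open>auto simp: closed_nbhd_def\<close>)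
      then show False using uv irr by blast
    qed
    then have "edge_up E \<union> prime_up Z = edge_up (\<lambda>_ _. False) \<union> prime_up Z"
      by (intro edge_up_cong) auto
    also have "\<dots> = prime_up Z" by (simp add: edge_up_def)
    finally have *: "edge_up E \<union> prime_up Z = prime_up Z" .
    have "r \<le> card {c \<in> C. \<not> closed_nbhd E c \<subseteq> Z}"
      using less.prems
      by (rule order_trans) (intro card_mono, auto simp: safe_def closed_nbhd_def)
    then show ?thesis unfolding * by (rule prime)
  qed
qed

text \<open>The graph \<open>R\<close>, with loops, describes \<open>I^2 : ab\<close>. Branching
  runs over the vertices of \<open>N(a)\<close> and \<open>N(b)\<close> other than \<open>a\<close>
  and \<open>b\<close>: keeping one removes all new edges at once, and once all are deleted none is
  left, so \<open>weakly_regular_safe\<close> takes over.\<close>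

lemma weakly_regular_edge_colon:
  fixes f :: "nat \<Rightarrow> ('v::finite, 'k::field) mpoly"
  assumes E: "simple_graph E" and C: "star_packing E C"
    and prime: "\<And>Z. r \<le> card {c \<in> C. \<not> closed_nbhd E c \<subseteq> Z} \<Longrightarrow>
      weakly_regular f r (mon_ideal (prime_up Z))"
    and ab: "E a b"
    and one: "\<And>x. r \<le> card {c \<in> C. \<not> E c x}"
    and tri: "\<And>u. E a u \<Longrightarrow> E b u \<Longrightarrow> r \<le> card {c \<in> C. \<not> E c a \<and> \<not> E c b \<and> \<not> E c u}"
  defines "R \<equiv> \<lambda>u v. E u v \<or> E a u \<and> E b v \<or> E b u \<and> E a v"
  shows "Z \<subseteq> {w. E a w \<or> E b w} - {a, b} \<Longrightarrow>
    weakly_regular f r (mon_ideal (edge_up R \<union> prime_up Z))"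
proof (induction "card (- Z)" arbitrary: Z rule: less_induct)
  case less
  have sym: "\<And>x y. E x y \<Longrightarrow> E y x" and irr: "\<And>x. \<not> E x x"
    using E by (auto simp: simple_graph_def)
  have symE: "symp E" using sym by (auto intro: sympI)
  have symR: "symp R" using sym unfolding R_def by (blast intro: sympI)
  have safe: "weakly_regular f r (mon_ideal (edge_up E \<union> prime_up Z))"
    if "r \<le> card {c \<in> C. P c}" "\<And>c. c \<in> C \<Longrightarrow> P c \<Longrightarrow> safe E Z c" for P Z
  proof (rule weakly_regular_safe[OF E C prime])
    show "r \<le> card {c \<in> C. safe E Z c}"
      using that(1) by (rule order_trans) (intro card_mono, use that(2) in auto)
  qed
  show ?case
  proof (cases "\<exists>u. (E a u \<or> E b u) \<and> u \<noteq> a \<and> u \<noteq> b \<and> u \<notin> Z")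
    case True
    then obtain u where u: "E a u \<or> E b u" "u \<noteq> a" "u \<noteq> b" "u \<notin> Z" by blast
    let ?Z = "Z \<union> {w. R u w}"
    show ?thesis
    proof (rule weakly_regular_vertex_branch[OF symR u(4)])
      show "weakly_regular f r (mon_ideal (edge_up R \<union> prime_up (insert u Z)))"
      proof (rule less.hyps)
        show "card (- insert u Z) < card (- Z)"
          using u by (intro psubset_card_mono) auto
      qed (use u less.prems in auto)
      \<comment> \<open>The \<open>R\<close>-neighbours of \<open>u\<close> include all of
        \<open>N(b)\<close> if \<open>u\<close> is in \<open>N(a)\<close>, and all of
        \<open>N(a)\<close> otherwise; every new edge has an endpoint in each of these sets.\<close>
      have *: "edge_up R \<union> prime_up ?Z = edge_up E \<union> prime_up ?Z"
        by (rule edge_up_cong) (use u in \<open>auto simp: R_def\<close>)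
      show "weakly_regular f r (mon_ideal (edge_up R \<union> prime_up ?Z))"
        unfolding *
      proof (cases "E a u \<and> E b u")
        case True
        \<comment> \<open>For a common neighbour, \<open>?Z\<close> lies in \<open>N(a)\<close>,
          \<open>N(b)\<close> and \<open>N(u)\<close> together, so only centers adjacent to
          \<open>a\<close>, \<open>b\<close> or \<open>u\<close> can be removed.\<close>
        show "weakly_regular f r (mon_ideal (edge_up E \<union> prime_up ?Z))"
          by (rule safe[OF tri[of u]])
            (use True less.prems sym in \<open>auto simp: safe_def R_def\<close>)
      next
        case False
        \<comment> \<open>With \<open>u\<close> adjacent to \<open>x\<close> only, both
          \<open>u\<close> and \<open>y\<close> stay and lose all their neighbours, so stars
          containing one of them are safe. Only a center adjacent to \<open>x\<close> can be
          lost.\<close>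
        have nonadj: "safe E ?Z c"
          if xy: "E x y" "E x u" "\<not> E y u" "\<not> E c x" "(x = a \<and> y = b) \<or> (x = b \<and> y = a)" "c \<in> C" for x y c
        proof (cases "c \<in> ?Z")
          case True
          have R: "R u w \<longleftrightarrow> E u w \<or> E y w" for w
            using xy(1-3,5) sym unfolding R_def by blast
          have "E c u \<or> E c y" using True R less.prems xy sym by blast
          then show ?thesis
          proof
            assume "E c u"
            then have "u \<in> closed_nbhd E c - ?Z" using u(4) R irr xy(3) by (auto simp: closed_nbhd_def)
            moreover have "{w. E u w} \<subseteq> ?Z" using R by blast
            ultimately show ?thesis unfolding safe_def by blast
          next
            assume "E c y"
            then have "y \<in> closed_nbhd E c - ?Z"
              using R irr xy sym less.prems by (auto simp: closed_nbhd_def)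
            moreover have "{w. E y w} \<subseteq> ?Z" using R by blast
            ultimately show ?thesis unfolding safe_def by blast
          qed
        qed (simp add: safe_def)
        show "weakly_regular f r (mon_ideal (edge_up E \<union> prime_up ?Z))"
        proof (cases "E a u")
          case True
          show ?thesis by (rule safe[OF one[of a]], rule nonadj[of a b]) (use True False ab in auto)
        next
          case nau: False
          show ?thesis by (rule safe[OF one[of b]], rule nonadj[of b a]) (use nau u(1) sym[OF ab] in auto)
        qed
      qed
    qed
  next
    case False
    have a: "a \<notin> Z" using less.prems by auto
    \<comment> \<open>Outside \<open>Z\<close> the only members of \<open>N(a)\<close> and
      \<open>N(b)\<close> are \<open>b\<close> and \<open>a\<close>, so the only new edge is
      \<open>ab\<close>, already in \<open>E\<close>.\<close>
    have *: "edge_up R \<union> prime_up Z = edge_up E \<union> prime_up Z"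
      by (rule edge_up_cong) (use False sym ab irr in \<open>unfold R_def, blast\<close>)
    show ?thesis
      unfolding *
    \<comment> \<open>Keeping \<open>a\<close> makes \<open>a\<close> a witness, so at most a center
      adjacent to \<open>b\<close> is lost; deleting \<open>a\<close> isolates \<open>b\<close>, so
      at most a center adjacent to \<open>a\<close> is lost.\<close>
    proof (rule weakly_regular_vertex_branch[OF symE a])
      show "weakly_regular f r (mon_ideal (edge_up E \<union> prime_up (Z \<union> {w. E a w})))"
      proof (rule safe[OF one[of b]])
        fix c assume "c \<in> C" "\<not> E c b"
        then show "safe E (Z \<union> {w. E a w}) c"
          using less.prems sym irr ab a unfolding safe_def closed_nbhd_def by blast
      qed
      show "weakly_regular f r (mon_ideal (edge_up E \<union> prime_up (insert a Z)))"
      proof (rule safe[OF one[of a]])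
        fix c assume "c \<in> C" "\<not> E c a"
        moreover have "b \<notin> insert a Z" using less.prems irr ab by auto
        moreover have "{w. E b w} \<subseteq> insert a Z" using False irr by blast
        ultimately show "safe E (insert a Z) c"
          using less.prems sym irr ab unfolding safe_def closed_nbhd_def by blast
      qed
    qed
  qed
qed

section \<open>The square of an edge ideal\<close>

definition sq_up :: "('v \<Rightarrow> 'v \<Rightarrow> bool) \<Rightarrow> ('v \<Rightarrow>\<^sub>0 nat) set" where
  "sq_up E = {p + q | p q. p \<in> edge_up E \<and> q \<in> edge_up E}"

lemma upset_sq_up: "upset (sq_up E)"
  unfolding upset_def sq_up_def
proof (intro allI impI)
  fix a b assume "b \<in> {p + q |p q. p \<in> edge_up E \<and> q \<in> edge_up E}"
  then obtain p q where "p \<in> edge_up E" "q \<in> edge_up E" "b = p + q" by blast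
  then show "a + b \<in> {p + q |p q. p \<in> edge_up E \<and> q \<in> edge_up E}"
    using upset_edge_up[of E] by (intro CollectI exI[of _ "a + p"] exI[of _ q])
      (auto simp: upset_def add.assoc)
qed

text \<open>Divisibility by a product of two edges, with endpoints counted by indicators so that
  coincidences among the four endpoints become arithmetic.\<close>

lemma sq_up_iff:
  assumes "simple_graph E"
  shows "x \<in> sq_up E \<longleftrightarrow> (\<exists>u v u' v'. E u v \<and> E u' v' \<and>
    (\<forall>w. of_bool (w = u) + of_bool (w = v) + of_bool (w = u') + of_bool (w = v')
      \<le> Poly_Mapping.lookup x w))" (is "_ \<longleftrightarrow> ?rhs")
proof
  have irr: "\<And>u. \<not> E u u" using assms by (auto simp: simple_graph_def)
  have ge: "\<exists>u v. E u v \<and> (\<forall>w. of_bool (w = u) + of_bool (w = v) \<le> Poly_Mapping.lookup p w)"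
    if p: "p \<in> edge_up E" for p
  proof -
    from p obtain u v where uv: "E u v" "0 < Poly_Mapping.lookup p u" "0 < Poly_Mapping.lookup p v"
      by (auto simp: edge_up_def)
    then have "u \<noteq> v" using irr by auto
    then show ?thesis using uv by (intro exI[of _ u] exI[of _ v]) (auto simp: of_bool_def)
  qed
  assume "x \<in> sq_up E"
  then obtain p q where pq: "p \<in> edge_up E" "q \<in> edge_up E" "x = p + q" by (auto simp: sq_up_def)
  from ge[OF pq(1)] obtain u v where uv: "E u v"
    "\<And>w. of_bool (w = u) + of_bool (w = v) \<le> Poly_Mapping.lookup p w" by blast
  from ge[OF pq(2)] obtain u' v' where uv': "E u' v'"
    "\<And>w. of_bool (w = u') + of_bool (w = v') \<le> Poly_Mapping.lookup q w" by blast
  have "of_bool (w = u) + of_bool (w = v) + of_bool (w = u') + of_bool (w = v')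
      \<le> Poly_Mapping.lookup x w" for w
    using add_mono[OF uv(2) uv'(2), of w w] by (simp add: pq(3) lookup_add add.assoc)
  then show ?rhs using uv(1) uv'(1) by blast
next
  have irr: "\<And>u. \<not> E u u" using assms by (auto simp: simple_graph_def)
  assume ?rhs
  then obtain u v u' v' where uv: "E u v" "E u' v'" and
    le: "\<And>w. of_bool (w = u) + of_bool (w = v) + of_bool (w = u') + of_bool (w = v')
      \<le> Poly_Mapping.lookup x w" by blast
  define p where "p = Poly_Mapping.single u (1::nat) + Poly_Mapping.single v 1"
  have p: "Poly_Mapping.lookup p w = of_bool (w = u) + of_bool (w = v)" for w
    by (auto simp: p_def lookup_add lookup_single when_def)
  \<comment> \<open>Subtraction of exponents is truncated; \<open>le\<close> makes it exact
    here.\<close>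
  have x: "x = p + (x - p)"
  proof (rule poly_mapping_eqI)
    fix w show "Poly_Mapping.lookup x w = Poly_Mapping.lookup (p + (x - p)) w"
      using le[of w] by (simp add: lookup_add lookup_minus p)
  qed
  have "p \<in> edge_up E" using uv(1) irr by (intro edge_upI[of E u v]) (auto simp: p)
  moreover have "x - p \<in> edge_up E"
    using uv(2) irr le[of u'] le[of v']
    by (intro edge_upI[of E u' v']) (auto simp: p lookup_minus)
  ultimately show "x \<in> sq_up E" unfolding sq_up_def using x by blast
qed

lemma sq_up_subset: "sq_up E \<subseteq> edge_up E"
  using upset_edge_up[of E] by (auto simp: sq_up_def upset_def)

lemma range_add_edge:
  assumes "a \<noteq> b"
  shows "range ((+) (Poly_Mapping.single a (1::nat) + Poly_Mapping.single b 1))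
    = edge_up (\<lambda>u v. u = a \<and> v = b \<or> u = b \<and> v = a)" (is "range ((+) ?e) = _")
proof (intro equalityI subsetI)
  fix x assume "x \<in> range ((+) ?e)"
  then show "x \<in> edge_up (\<lambda>u v. u = a \<and> v = b \<or> u = b \<and> v = a)"
    using assms by (auto simp: lookup_add lookup_single when_def intro!: edge_upI[of _ a b])
next
  fix x assume "x \<in> edge_up (\<lambda>u v. u = a \<and> v = b \<or> u = b \<and> v = a)"
  then have ab: "0 < Poly_Mapping.lookup x a" "0 < Poly_Mapping.lookup x b" by (auto simp: edge_up_def)
  have "x = ?e + (x - ?e)"
    by (rule poly_mapping_eqI) (use ab assms in \<open>auto simp: lookup_add lookup_minus lookup_single when_def\<close>)
  then show "x \<in> range ((+) ?e)" by blast
qed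

text \<open>If \<open>ab\<close> times a monomial is divisible by two edges, neither of which
  divides the monomial, then \<open>a\<close> supplies an endpoint of one edge and \<open>b\<close>
  one of the other. The remaining endpoints form a new edge between \<open>N(a)\<close> and
  \<open>N(b)\<close>.\<close>

lemma colon_sq_up:
  assumes E: "simple_graph E" and Q: "symp Q" "\<forall>u v. Q u v \<longrightarrow> E u v" and ab: "E a b" "\<not> Q a b"
  shows "{x. Poly_Mapping.single a 1 + Poly_Mapping.single b 1 + x \<in> sq_up E \<union> edge_up Q}
    = edge_up (\<lambda>u v. E u v \<or> E a u \<and> E b v \<or> E b u \<and> E a v) \<union> prime_up {w. Q a w \<or> Q b w}"
    (is "{x. ?e + x \<in> _} = edge_up ?R \<union> prime_up ?W")
proof (intro equalityI subsetI)
  have sym: "\<And>x y. E x y \<Longrightarrow> E y x" and irr: "\<And>x. \<not> E x x"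
    using E by (auto simp: simple_graph_def)
  have ne: "a \<noteq> b" using ab irr by auto
  have L: "Poly_Mapping.lookup (?e + x) w = of_bool (w = a) + of_bool (w = b) + Poly_Mapping.lookup x w" for x w
    by (auto simp: lookup_add lookup_single when_def)
  fix x assume "x \<in> {x. ?e + x \<in> sq_up E \<union> edge_up Q}"
  then consider "?e + x \<in> sq_up E" | "?e + x \<in> edge_up Q" by auto
  then show "x \<in> edge_up ?R \<union> prime_up ?W"
  proof cases
    case 1
    let ?X = "Poly_Mapping.lookup x"
    from 1 obtain u v u' v' where uv: "E u v" "E u' v'" and
      le: "\<And>w. of_bool (w = u) + of_bool (w = v) + of_bool (w = u') + of_bool (w = v')
        \<le> of_bool (w = a) + of_bool (w = b) + ?X w"
      unfolding sq_up_iff[OF E] L by blast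
    have edge: "x \<in> edge_up ?R" if "E p q" "0 < ?X p" "0 < ?X q" for p q
      using that irr by (intro edge_upI[of _ p q]) auto
    show ?thesis
    proof (cases "(0 < ?X u \<and> 0 < ?X v) \<or> (0 < ?X u' \<and> 0 < ?X v')")
      case True
      then show ?thesis using edge uv by blast
    next
      case False
      \<comment> \<open>\<open>p\<close> and \<open>p'\<close> are endpoints of the two edges that
        do not divide \<open>x\<close>; \<open>q\<close> and \<open>q'\<close> are the opposite
        ones.\<close>
      obtain p q where pq: "E p q" "?X p = 0" "(p = u \<and> q = v) \<or> (p = v \<and> q = u)"
        using False uv sym by blast
      obtain p' q' where pq': "E p' q'" "?X p' = 0" "(p' = u' \<and> q' = v') \<or> (p' = v' \<and> q' = u')"
        using False uv sym by blast
      have le': "of_bool (w = p) + of_bool (w = q) + of_bool (w = p') + of_bool (w = q')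
        \<le> of_bool (w = a) + of_bool (w = b) + ?X w" for w
        using pq(3) pq'(3) le[of w] by (elim disjE conjE) (simp_all add: ac_simps)
      have "p \<noteq> q" "p' \<noteq> q'" using pq pq' irr by auto
      have "p = a \<or> p = b" using le'[of p] pq by (auto split: if_splits simp: of_bool_def)
      moreover have "p' = a \<or> p' = b" using le'[of p'] pq' by (auto split: if_splits simp: of_bool_def)
      moreover have "p \<noteq> p'" using le'[of p] pq ne by (auto split: if_splits simp: of_bool_def)
      ultimately have pp: "(p = a \<and> p' = b) \<or> (p = b \<and> p' = a)" by blast
      have "q \<noteq> p'" using le'[of p'] pq' pp ne by (auto split: if_splits simp: of_bool_def)
      have "q' \<noteq> p" using le'[of p] pq pp ne by (auto split: if_splits simp: of_bool_def)
      have qab: "q \<noteq> a" "q \<noteq> b" "q' \<noteq> a" "q' \<noteq> b"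
        using \<open>q \<noteq> p'\<close> \<open>q' \<noteq> p\<close> \<open>p \<noteq> q\<close> \<open>p' \<noteq> q'\<close> pp by blast+
      have q: "0 < ?X q" "0 < ?X q'" using le'[of q] le'[of q'] qab by simp_all
      \<comment> \<open>Coinciding remaining endpoints are counted twice, which is the condition for
        a loop in \<open>edge_up\<close>.\<close>
      have qq: "1 < ?X q" if "q = q'" using le'[of q] qab that by simp
      have "?R q q'" using pp pq(1) pq'(1) by blast
      then show ?thesis using q qq by (intro UnI1 edge_upI[of ?R q q'])
    qed
  next
    case 2
    then obtain s t where "Q s t" "0 < Poly_Mapping.lookup (?e + x) s"
        "0 < Poly_Mapping.lookup (?e + x) t"
      unfolding edge_up_def by blast
    then have st: "Q s t" "s = a \<or> s = b \<or> 0 < Poly_Mapping.lookup x s"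
        "t = a \<or> t = b \<or> 0 < Poly_Mapping.lookup x t"
      unfolding L by (auto simp: of_bool_def split: if_splits)
    have "s \<noteq> t" using Q(2) st irr by blast
    \<comment> \<open>As \<open>ab\<close> is not yet an edge of \<open>Q\<close>, it cannot supply
      both endpoints of a \<open>Q\<close>-edge.\<close>
    have nst: "\<not> ((s = a \<or> s = b) \<and> (t = a \<or> t = b))"
      using st(1) ab(2) sympD[OF Q(1)] \<open>s \<noteq> t\<close> by blast
    show ?thesis
    proof (cases "0 < Poly_Mapping.lookup x s \<and> 0 < Poly_Mapping.lookup x t")
      case True
      then show ?thesis using Q(2) st(1) \<open>s \<noteq> t\<close> by (intro UnI1 edge_upI[of _ s t]) auto
    next
      case False
      then have "x \<in> prime_up ?W"
        using st nst sympD[OF Q(1) st(1)] unfolding prime_up_def by blast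
      then show ?thesis by blast
    qed
  qed
next
  have sym: "\<And>x y. E x y \<Longrightarrow> E y x" and irr: "\<And>x. \<not> E x x"
    using E by (auto simp: simple_graph_def)
  have L: "Poly_Mapping.lookup (?e + x) w = of_bool (w = a) + of_bool (w = b) + Poly_Mapping.lookup x w" for x w
    by (auto simp: lookup_add lookup_single when_def)
  fix x assume "x \<in> edge_up ?R \<union> prime_up ?W"
  then consider u v where "?R u v" "0 < Poly_Mapping.lookup x u" "0 < Poly_Mapping.lookup x v"
      "u = v \<longrightarrow> 1 < Poly_Mapping.lookup x u"
    | w where "Q a w \<or> Q b w" "0 < Poly_Mapping.lookup x w"
    unfolding edge_up_def prime_up_def by blast
  then show "x \<in> {x. ?e + x \<in> sq_up E \<union> edge_up Q}"
  proof cases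
    case 1
    have le: "of_bool (w = u) + of_bool (w = v) \<le> Poly_Mapping.lookup x w" for w
      using 1 by (auto simp: of_bool_def)
    \<comment> \<open>The three orders match the pairs of edges \<open>au, bv\<close>, then
      \<open>bu, av\<close>, then \<open>uv, ab\<close>, one for each way to be an edge of the new
      graph.\<close>
    have le': "of_bool (w = a) + of_bool (w = u) + of_bool (w = b) + of_bool (w = v)
        \<le> of_bool (w = a) + of_bool (w = b) + Poly_Mapping.lookup x w"
      "of_bool (w = b) + of_bool (w = u) + of_bool (w = a) + of_bool (w = v)
        \<le> of_bool (w = a) + of_bool (w = b) + Poly_Mapping.lookup x w"
      "of_bool (w = u) + of_bool (w = v) + of_bool (w = a) + of_bool (w = b)
        \<le> of_bool (w = a) + of_bool (w = b) + Poly_Mapping.lookup x w" for w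
      using le[of w] by linarith+
    have "?e + x \<in> sq_up E"
      unfolding sq_up_iff[OF E] L using 1(1)
    proof (elim disjE conjE)
      assume "E u v"
      then show "\<exists>u v u' v'. E u v \<and> E u' v' \<and>
          (\<forall>w. of_bool (w = u) + of_bool (w = v) + of_bool (w = u') + of_bool (w = v')
            \<le> of_bool (w = a) + of_bool (w = b) + Poly_Mapping.lookup x w)"
        using ab(1) le'(3) by metis
    next
      assume "E a u" "E b v"
      then show "\<exists>u v u' v'. E u v \<and> E u' v' \<and>
          (\<forall>w. of_bool (w = u) + of_bool (w = v) + of_bool (w = u') + of_bool (w = v')
            \<le> of_bool (w = a) + of_bool (w = b) + Poly_Mapping.lookup x w)"
        using le'(1) by metis
    next
      assume "E b u" "E a v"
      then show "\<exists>u v u' v'. E u v \<and> E u' v' \<and>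
          (\<forall>w. of_bool (w = u) + of_bool (w = v) + of_bool (w = u') + of_bool (w = v')
            \<le> of_bool (w = a) + of_bool (w = b) + Poly_Mapping.lookup x w)"
        using le'(2) by metis
    qed
    then show ?thesis by simp
  next
    case 2
    then have "?e + x \<in> edge_up Q"
    proof (elim disjE)
      assume "Q a w"
      then show ?thesis using 2(2) Q(2) irr by (intro edge_upI[of Q a w]) (auto simp: L simp del: One_nat_def)
    next
      assume "Q b w"
      then show ?thesis using 2(2) Q(2) irr by (intro edge_upI[of Q b w]) (auto simp: L simp del: One_nat_def)
    qed
    then show ?thesis by simp
  qed
qed

text \<open>\<open>Q\<close> collects the edges adjoined so far. Each further edge \<open>ab\<close>
  is a branch whose colon is treated by \<open>weakly_regular_edge_colon\<close>; when
  \<open>Q = E\<close> only the edge ideal itself remains.\<close>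

lemma weakly_regular_sq:
  fixes f :: "nat \<Rightarrow> ('v::finite, 'k::field) mpoly"
  assumes E: "simple_graph E" and C: "star_packing E C"
    and prime: "\<And>Z. r \<le> card {c \<in> C. \<not> closed_nbhd E c \<subseteq> Z} \<Longrightarrow>
      weakly_regular f r (mon_ideal (prime_up Z))"
    and one: "\<And>x. r \<le> card {c \<in> C. \<not> E c x}"
    and tri: "\<And>a b u. E a b \<Longrightarrow> E a u \<Longrightarrow> E b u \<Longrightarrow>
      r \<le> card {c \<in> C. \<not> E c a \<and> \<not> E c b \<and> \<not> E c u}"
  shows "symp Q \<Longrightarrow> \<forall>u v. Q u v \<longrightarrow> E u v \<Longrightarrow>
    weakly_regular f r (mon_ideal (sq_up E \<union> edge_up Q))"
proof (induction "card {(u, v). E u v \<and> \<not> Q u v}" arbitrary: Q rule: less_induct)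
  case less
  have sym: "\<And>x y. E x y \<Longrightarrow> E y x" and irr: "\<And>x. \<not> E x x"
    using E by (auto simp: simple_graph_def)
  show ?case
  proof (cases "\<exists>a b. E a b \<and> \<not> Q a b")
    case True
    then obtain a b where ab: "E a b" "\<not> Q a b" by blast
    then have ne: "a \<noteq> b" using irr by auto
    let ?e = "Poly_Mapping.single a (1::nat) + Poly_Mapping.single b 1"
    let ?Q = "\<lambda>u v. Q u v \<or> u = a \<and> v = b \<or> u = b \<and> v = a"
    show ?thesis
    proof (rule weakly_regular_mon_branch[where a = ?e])
      show "upset (sq_up E \<union> edge_up Q)" by (intro upset_Un upset_sq_up upset_edge_up)
      show "weakly_regular f r (mon_ideal {x. ?e + x \<in> sq_up E \<union> edge_up Q})"
        unfolding colon_sq_up[OF E less.prems ab]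
      proof (rule weakly_regular_edge_colon[OF E C prime ab(1) one tri[OF ab(1)]])
        show "{w. Q a w \<or> Q b w} \<subseteq> {w. E a w \<or> E b w} - {a, b}"
          using less.prems(2) ab(2) sympD[OF less.prems(1)] irr by blast
      qed
      have "sq_up E \<union> edge_up Q \<union> range ((+) ?e) = sq_up E \<union> edge_up ?Q"
        unfolding range_add_edge[OF ne] edge_up_def by blast
      moreover have "weakly_regular f r (mon_ideal (sq_up E \<union> edge_up ?Q))"
      proof (rule less.hyps)
        show "card {(u, v). E u v \<and> \<not> ?Q u v} < card {(u, v). E u v \<and> \<not> Q u v}"
          using ab by (intro psubset_card_mono) auto
        show "symp ?Q" using sympD[OF less.prems(1)] by (intro sympI) blast
        show "\<forall>u v. ?Q u v \<longrightarrow> E u v" using less.prems(2) ab sym by blast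
      qed
      ultimately show "weakly_regular f r (mon_ideal (sq_up E \<union> edge_up Q \<union> range ((+) ?e)))" by simp
    qed
  next
    case False
    then have "Q = E" using less.prems(2) by blast
    then have "sq_up E \<union> edge_up Q = edge_up E \<union> prime_up {}"
      using sq_up_subset[of E] by (auto simp: prime_up_def)
    moreover have "weakly_regular f r (mon_ideal (edge_up E \<union> prime_up {}))"
    proof (rule weakly_regular_safe[OF E C prime])
      show "r \<le> card {c \<in> C. safe E {} c}"
        using one by (rule order_trans) (intro card_mono, auto simp: safe_def)
    qed
    ultimately show ?thesis by simp
  qed
qed

section \<open>Depth\<close>

lemma module_mult: "module ((*) :: 'a::comm_ring_1 \<Rightarrow> 'a \<Rightarrow> 'a)"
  by unfold_locales (auto simp: algebra_simps)

lemma gen_ideal_superset: "X \<subseteq> gen_ideal X"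
  unfolding gen_ideal_def by (rule module.span_superset[OF module_mult])

lemma gen_ideal_least: "is_ideal J \<Longrightarrow> X \<subseteq> J \<Longrightarrow> gen_ideal X \<subseteq> J"
  unfolding gen_ideal_def
  by (intro module.span_minimal[OF module_mult])
    (auto simp: module.subspace_def[OF module_mult] is_ideal_def)

lemma is_ideal_gen_ideal: "is_ideal (gen_ideal X)"
  using module.subspace_span[OF module_mult, of X]
  unfolding gen_ideal_def is_ideal_def module.subspace_def[OF module_mult] by blast

lemma edge_ideal_eq:
  assumes "simple_graph E"
  shows "(edge_ideal E :: ('v, 'k::field) mpoly set) = mon_ideal (edge_up E)"
proof
  have irr: "\<And>u. \<not> E u u" using assms by (auto simp: simple_graph_def)
  have var: "(var u * var v :: ('v, 'k) mpoly)
      = Poly_Mapping.single (Poly_Mapping.single u 1 + Poly_Mapping.single v 1) 1" for u v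
    by (simp add: var_def mult_single)
  show "edge_ideal E \<subseteq> (mon_ideal (edge_up E) :: ('v, 'k) mpoly set)"
    unfolding edge_ideal_def
  proof (rule gen_ideal_least[OF is_ideal_mon_ideal[OF upset_edge_up]])
    show "{var u * var v |u v. E u v} \<subseteq> (mon_ideal (edge_up E) :: ('v, 'k) mpoly set)"
    proof clarify
      fix u v assume "E u v"
      then show "(var u * var v :: ('v, 'k) mpoly) \<in> mon_ideal (edge_up E)"
        unfolding var using irr
        by (intro single_in_mon_ideal edge_upI[of E u v]) (auto simp: lookup_add)
    qed
  qed
  show "mon_ideal (edge_up E) \<subseteq> (edge_ideal E :: ('v, 'k) mpoly set)"
  proof
    fix f :: "('v, 'k) mpoly" assume f: "f \<in> mon_ideal (edge_up E)"
    have I: "is_ideal (edge_ideal E :: ('v, 'k) mpoly set)"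
      unfolding edge_ideal_def by (rule is_ideal_gen_ideal)
    show "f \<in> edge_ideal E"
    proof (rule is_ideal_monomialwise[OF I])
      fix k and c :: 'k assume "k \<in> Poly_Mapping.keys f"
      then have "k \<in> edge_up E" using f by (auto simp: mon_ideal_def)
      then obtain u v where uv: "E u v" "0 < Poly_Mapping.lookup k u" "0 < Poly_Mapping.lookup k v"
        by (auto simp: edge_up_def)
      then have "u \<noteq> v" using irr by auto
      let ?e = "Poly_Mapping.single u (1::nat) + Poly_Mapping.single v 1"
      have "k = (k - ?e) + ?e"
        by (rule poly_mapping_eqI)
          (use uv \<open>u \<noteq> v\<close> in \<open>auto simp: lookup_add lookup_minus lookup_single when_def\<close>)
      then have "Poly_Mapping.single k c = Poly_Mapping.single (k - ?e) c * (var u * var v)"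
        unfolding var mult_single by simp
      moreover have "var u * var v \<in> (edge_ideal E :: ('v, 'k) mpoly set)"
        unfolding edge_ideal_def using uv(1) by (intro set_mp[OF gen_ideal_superset]) blast
      ultimately show "Poly_Mapping.single k c \<in> edge_ideal E" by (simp add: is_ideal_mult[OF I])
    qed
  qed
qed

lemma ideal_prod_mon_ideal:
  assumes "upset U"
  shows "ideal_prod (mon_ideal U) (mon_ideal V :: ('v, 'k::field) mpoly set)
    = mon_ideal {p + q | p q. p \<in> U \<and> q \<in> V}"
proof
  let ?W = "{p + q | p q. p \<in> U \<and> q \<in> V}"
  have W: "upset ?W"
    unfolding upset_def
  proof clarify
    fix a p q assume "p \<in> U" "q \<in> V"
    then show "\<exists>p' q'. a + (p + q) = p' + q' \<and> p' \<in> U \<and> q' \<in> V"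
      using assms by (intro exI[of _ "a + p"] exI[of _ q]) (auto simp: upset_def add.assoc)
  qed
  show "ideal_prod (mon_ideal U) (mon_ideal V) \<subseteq> (mon_ideal ?W :: ('v, 'k) mpoly set)"
    unfolding ideal_prod_def
  proof (rule gen_ideal_least[OF is_ideal_mon_ideal[OF W]])
    show "{a * b |a b. a \<in> mon_ideal U \<and> b \<in> mon_ideal V} \<subseteq> (mon_ideal ?W :: ('v, 'k) mpoly set)"
    proof clarify
      fix a b :: "('v, 'k) mpoly" assume "a \<in> mon_ideal U" "b \<in> mon_ideal V"
      then show "a * b \<in> mon_ideal ?W"
        using keys_mult[of a b] unfolding mon_ideal_def by blast
    qed
  qed
  show "mon_ideal ?W \<subseteq> (ideal_prod (mon_ideal U) (mon_ideal V) :: ('v, 'k) mpoly set)"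
  proof
    fix f :: "('v, 'k) mpoly" assume f: "f \<in> mon_ideal ?W"
    show "f \<in> ideal_prod (mon_ideal U) (mon_ideal V)"
      unfolding ideal_prod_def
    proof (rule is_ideal_monomialwise[OF is_ideal_gen_ideal])
      fix k and c :: 'k assume "k \<in> Poly_Mapping.keys f"
      then obtain p q where pq: "p \<in> U" "q \<in> V" "k = p + q" using f by (auto simp: mon_ideal_def)
      then have "Poly_Mapping.single k c = Poly_Mapping.single p c * Poly_Mapping.single q 1"
        by (simp add: mult_single)
      then show "Poly_Mapping.single k c \<in> gen_ideal {a * b |a b. a \<in> mon_ideal U \<and> b \<in> mon_ideal V}"
        using pq(1,2) single_in_mon_ideal by (intro set_mp[OF gen_ideal_superset]) blast
    qed
  qed
qed

section \<open>From regularity on the quotient to the depth of the ideal\<close>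

lemma mem_adjoin_seq: "is_ideal J \<Longrightarrow> j < i \<Longrightarrow> f j \<in> adjoin_seq f i J"
proof (induction i)
  case (Suc i)
  show ?case
  proof (cases "j = i")
    case True
    then show ?thesis
      using is_ideal_zero[OF is_ideal_adjoin_seq[OF Suc.prems(1), of f i]] by (auto intro: adjoinI[of 0 _ _ 1])
  next
    case False
    then show ?thesis using Suc subset_adjoin[of "adjoin_seq f i J" "f i"] by auto
  qed
qed simp

text \<open>Write \<open>M\<close> for the ideal and \<open>F\<close> for the ideal of the first
  \<open>i\<close> elements. Regularity on \<open>S/M\<close> gives that \<open>F\<close> and
  \<open>M\<close> intersect in \<open>F M\<close>, so regularity on \<open>S\<close> restricts to
  \<open>M\<close>. Regularity of \<open>f r\<close> on \<open>M\<close> involves only the first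
  \<open>r\<close> elements on \<open>S/M\<close>, hence the gain of one.\<close>

lemma depth_mon_ideal_ge:
  fixes f :: "nat \<Rightarrow> ('v::finite, 'k::field) mpoly"
  assumes U: "upset U" and hom: "\<And>i. homogeneous (Suc i) (f i)"
    and quot: "weakly_regular f r (mon_ideal U)" and ring: "weakly_regular f (Suc r) {0}"
  shows "enat (Suc r) \<le> depth (mon_ideal U :: ('v, 'k) mpoly set)"
proof (cases "mon_ideal U = ({0} :: ('v, 'k) mpoly set)")
  case True
  \<comment> \<open>This happens for a graph without edges; the depth is infinite by
    convention.\<close>
  then show ?thesis by (simp add: depth_def)
next
  case False
  let ?M = "mon_ideal U :: ('v, 'k) mpoly set"
  let ?S = "\<lambda>i. seq_mul (map f [0..<i]) ?M"
  let ?F = "\<lambda>i. adjoin_seq f i {0}"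
  have M: "is_ideal ?M" by (rule is_ideal_mon_ideal[OF U])
  have F: "is_ideal (?F i)" for i by (intro is_ideal_adjoin_seq is_ideal_zero_ideal)
  have S: "is_ideal (?S i)" for i unfolding seq_mul_def by (rule is_ideal_gen_ideal)
  have SI: "f j * g \<in> ?S i" if "j < i" "g \<in> ?M" for i j g
  proof -
    have "f j \<in> set (map f [0..<i])" using that(1) by simp
    then show ?thesis
      unfolding seq_mul_def using that(2) by (intro set_mp[OF gen_ideal_superset]) blast
  qed
  have SF: "?S i \<subseteq> ?F i" for i
    unfolding seq_mul_def
    by (rule gen_ideal_least[OF F])
      (auto intro!: is_ideal_mult_right[OF F] mem_adjoin_seq is_ideal_zero_ideal)
  have S_mono: "?S i \<subseteq> ?S (Suc i)" for i
    unfolding seq_mul_def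
    by (rule gen_ideal_least[OF is_ideal_gen_ideal], rule order_trans[OF _ gen_ideal_superset]) auto
  have FS: "g \<in> ?S i" if "i \<le> r" "g \<in> ?F i" "g \<in> ?M" for i g
    using that
  proof (induction i arbitrary: g)
    case 0
    then show ?case using is_ideal_zero[OF S, of 0] by simp
  next
    case (Suc j)
    then obtain a b where b: "b \<in> ?F j" and g: "g = a * f j + b" by (auto simp: adjoin_def)
    have Fsub: "?F j \<subseteq> adjoin_seq f j ?M"
      using is_ideal_zero[OF M] by (intro adjoin_seq_mono) auto
    \<comment> \<open>Regularity on the quotient splits \<open>a\<close> into \<open>c\<close> in
      \<open>?F j\<close> and \<open>d\<close> in \<open>?M\<close>; subtracting
      \<open>d * f j\<close> leaves an element of both \<open>?F j\<close> and
      \<open>?M\<close>.\<close>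
    have "f j * a = g - b" by (simp add: g mult.commute)
    also have "\<dots> \<in> adjoin_seq f j ?M"
      using Suc.prems(3) subset_adjoin_seq b Fsub by (intro is_ideal_diff[OF is_ideal_adjoin_seq[OF M]]) blast+
    finally have "a \<in> adjoin_seq f j ?M"
      using weakly_regularD[OF quot, of j a] Suc.prems(1) by simp
    then obtain c d where cd: "c \<in> ?F j" "d \<in> ?M" "a = c + d"
      using adjoin_seq_decompose[OF M] by blast
    have "g - d * f j = c * f j + b" by (simp add: g cd(3) algebra_simps)
    moreover have "c * f j + b \<in> ?F j"
      by (rule is_ideal_add[OF F is_ideal_mult_right[OF F cd(1)] b])
    moreover have "g - d * f j \<in> ?M"
      by (rule is_ideal_diff[OF M Suc.prems(3) is_ideal_mult_right[OF M cd(2)]])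
    ultimately have "g - d * f j \<in> ?S j" using Suc.IH[of "g - d * f j"] Suc.prems(1) by simp
    then have "g - d * f j \<in> ?S (Suc j)" using S_mono by blast
    moreover have "d * f j \<in> ?S (Suc j)" using SI[of j "Suc j" d] cd(2) by (simp add: mult.commute)
    ultimately show ?case using is_ideal_add[OF S, of "g - d * f j" "Suc j" "d * f j"] by simp
  qed
  have "?S (Suc r) \<noteq> ?M"
  proof
    assume eq: "?S (Suc r) = ?M"
    obtain h where h: "h \<in> ?M" "h \<noteq> 0" using False is_ideal_zero[OF M] by blast
    then obtain k0 where "k0 \<in> U"
      unfolding mon_ideal_def by (metis (mono_tags, lifting) keys_eq_empty mem_Collect_eq subset_empty subsetI subsetD)
    \<comment> \<open>The \<open>f i\<close> have positive degree, so a monomial of least degree in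
      the ideal is not in the product.\<close>
    then obtain k where k: "k \<in> U" "\<And>l. l \<in> U \<Longrightarrow> mdeg k \<le> mdeg l"
      using ex_has_least_nat[of "\<lambda>k. k \<in> U" k0 mdeg] by blast
    let ?D = "{l. mdeg k < mdeg l}"
    have "upset ?D" by (auto simp: upset_def mdeg_add)
    then have "?S (Suc r) \<subseteq> mon_ideal ?D"
      unfolding seq_mul_def
    proof (rule gen_ideal_least[OF is_ideal_mon_ideal])
      show "{x * g |x g. x \<in> set (map f [0..<Suc r]) \<and> g \<in> ?M} \<subseteq> mon_ideal ?D"
      proof clarify
        fix x g assume x: "x \<in> set (map f [0..<Suc r])" and g: "g \<in> ?M"
        then obtain i where "x = f i" by auto
        show "x * g \<in> mon_ideal ?D"
          unfolding mon_ideal_def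
        proof (intro CollectI subsetI)
          fix l assume "l \<in> Poly_Mapping.keys (x * g)"
          then obtain p q where pq: "p \<in> Poly_Mapping.keys x" "q \<in> Poly_Mapping.keys g" "l = p + q"
            using keys_mult[of x g] by blast
          have "mdeg p = Suc i" using pq(1) hom[of i] \<open>x = f i\<close> by (auto simp: homogeneous_def)
          moreover have "mdeg k \<le> mdeg q" using pq(2) g k(2) by (auto simp: mon_ideal_def)
          ultimately show "mdeg k < mdeg l" by (simp add: pq(3) mdeg_add)
        qed
      qed
    qed
    moreover have "Poly_Mapping.single k 1 \<in> ?M" using k(1) by (rule single_in_mon_ideal)
    ultimately have "Poly_Mapping.single k (1::'k) \<in> mon_ideal ?D" using eq by blast
    then show False by (simp add: mon_ideal_def)
  qed
  moreover have "set (map f [0..<Suc r]) \<subseteq> max_ideal"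
  proof
    fix x assume "x \<in> set (map f [0..<Suc r])"
    then obtain i where x: "x = f i" by auto
    have "0 \<notin> Poly_Mapping.keys (f i)" using hom[of i] by (auto simp: homogeneous_def mdeg_zero)
    then show "x \<in> max_ideal" by (simp add: max_ideal_def x in_keys_iff)
  qed
  moreover have "g \<in> ?S i" if i: "i < Suc r" and g: "g \<in> ?M" "f i * g \<in> ?S i" for i g
    using FS[of i g] weakly_regularD[OF ring i, of g] SF[of i] i g by auto
  ultimately have "regular_seq ?M (map f [0..<Suc r])"
    unfolding regular_seq_def by (simp add: take_map del: upt_Suc)
  then have "enat (length (map f [0..<Suc r])) \<in> {enat (length fs) | fs. regular_seq ?M fs}" by blast
  then have "enat (length (map f [0..<Suc r])) \<le> Sup {enat (length fs) | fs. regular_seq ?M fs}"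
    by (rule Sup_upper)
  then show ?thesis using False by (simp add: depth_def)
qed

section \<open>Counting the stars near a triangle\<close>

lemma star_packing_near:
  fixes E :: "'v::finite \<Rightarrow> 'v \<Rightarrow> bool"
  assumes "star_packing E C" shows "card {c \<in> C. E c x} \<le> 1"
proof -
  have "c = d" if "c \<in> C" "d \<in> C" "E c x" "E d x" for c d
    using star_packing_eq[OF assms that(1,2), of x] that by (auto simp: closed_nbhd_def)
  then show ?thesis by (auto simp: card_le_Suc0_iff_eq)
qed

text \<open>At most \<open>Suc k\<close> stars are lost on the way from \<open>S/I^2\<close> to a
  prime, and passing from the quotient to the ideal wins one back.\<close>

lemma depth_sq_ge:
  fixes E :: "'v::finite \<Rightarrow> 'v \<Rightarrow> bool"
  assumes E: "simple_graph E" and C: "star_packing E C"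
    and tri: "\<And>a b u. E a b \<Longrightarrow> E a u \<Longrightarrow> E b u \<Longrightarrow>
      card {c \<in> C. E c a \<or> E c b \<or> E c u} \<le> Suc k"
  shows "enat (card C - k)
    \<le> depth (ideal_prod (edge_ideal E :: ('v, 'k::field) mpoly set) (edge_ideal E))"
proof (cases "card C \<le> k")
  case True
  then show ?thesis by (simp flip: zero_enat_def)
next
  case False
  define r where "r = card C - Suc k"
  let ?f = "\<lambda>i. block_esym (closed_nbhd E) C (Suc i) :: ('v, 'k) mpoly"
  have prime: "weakly_regular ?f s (mon_ideal (prime_up Z))"
    if "s \<le> card {c \<in> C. \<not> closed_nbhd E c \<subseteq> Z}" for s Z
    by (rule weakly_regular_prime[OF _ _ that]) (use C in \<open>auto simp: star_packing_def\<close>)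
  have compl: "card {c \<in> C. \<not> P c} = card C - card {c \<in> C. P c}" for P
  proof -
    have "{c \<in> C. \<not> P c} = C - {c \<in> C. P c}" by auto
    then show ?thesis by (simp add: card_Diff_subset)
  qed
  have "weakly_regular ?f r (mon_ideal (sq_up E \<union> edge_up (\<lambda>_ _. False)))"
  proof (rule weakly_regular_sq[OF E C prime])
    show "r \<le> card {c \<in> C. \<not> E c x}" for x
      using star_packing_near[OF C, of x] False unfolding compl r_def by linarith
    show "r \<le> card {c \<in> C. \<not> E c a \<and> \<not> E c b \<and> \<not> E c u}" if "E a b" "E a u" "E b u" for a b u
      using tri[OF that] compl[of "\<lambda>c. E c a \<or> E c b \<or> E c u"] by (simp add: r_def)
  qed (auto intro: sympI)
  then have quot: "weakly_regular ?f r (mon_ideal (sq_up E))" by (simp add: edge_up_def)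
  \<comment> \<open>For empty \<open>Z\<close> the prime is the zero ideal and all stars
    survive.\<close>
  have "weakly_regular ?f (Suc r) (mon_ideal (prime_up {}))"
    by (rule prime) (use False in \<open>auto simp: r_def closed_nbhd_def\<close>)
  then have ring: "weakly_regular ?f (Suc r) {0}" by (simp add: prime_up_def mon_ideal_def)
  have "enat (Suc r) \<le> depth (mon_ideal (sq_up E) :: ('v, 'k) mpoly set)"
    by (rule depth_mon_ideal_ge[OF upset_sq_up homogeneous_block_esym quot ring]) simp
  moreover have "Suc r = card C - k" using False by (simp add: r_def)
  ultimately show ?thesis
    by (simp add: edge_ideal_eq[OF E] ideal_prod_mon_ideal[OF upset_edge_up] flip: sq_up_def)
qed

lemma WK3_iff: "WK3 i j \<longleftrightarrow> (i, j) \<in> {(0,1),(1,0),(1,2),(2,1),(0,2),(2,0),(0,3),(3,0),(1,4),(4,1),(2,5),(5,2)}"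
  unfolding WK3_def by (auto simp: doubleton_eq_iff)

text \<open>The three centers serve as the ends of the whiskers; disjointness of the stars excludes
  every further edge.\<close>

lemma has_induced_WK3:
  assumes E: "simple_graph E" and C: "star_packing E C"
    and abu: "E a b" "E a u" "E b u"
    and c: "p \<in> C" "q \<in> C" "s \<in> C" "E p a" "E q b" "E s u" "p \<noteq> q" "p \<noteq> s" "q \<noteq> s"
  shows "has_induced E {0..5} WK3"
proof -
  have sym: "\<And>x y. E x y \<longleftrightarrow> E y x" and irr: "\<And>x. \<not> E x x"
    using E by (auto simp: simple_graph_def)
  have far: "\<not> E x d \<and> \<not> E d x \<and> x \<noteq> d" if "c \<in> C" "d \<in> C" "c \<noteq> d" "E c x \<or> c = x" for c d x
    using star_packing_eq[OF C that(1,2), of x] that(3,4) sym by (auto simp: closed_nbhd_def)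
  \<comment> \<open>The order follows the numbering of \<open>WK3\<close>: triangle first, then the
    whisker ends in matching order.\<close>
  let ?L = "[a, b, u, p, q, s]"
  have far': "\<not> E a q" "\<not> E a s" "\<not> E b p" "\<not> E b s" "\<not> E u p" "\<not> E u q"
      "\<not> E q a" "\<not> E s a" "\<not> E p b" "\<not> E s b" "\<not> E p u" "\<not> E q u"
      "\<not> E p q" "\<not> E q p" "\<not> E p s" "\<not> E s p" "\<not> E q s" "\<not> E s q"
      "a \<noteq> q" "a \<noteq> s" "b \<noteq> p" "b \<noteq> s" "u \<noteq> p" "u \<noteq> q"
    using far c by blast+
  have near: "E b a" "E u a" "E u b" "E a p" "E b q" "E u s" using abu c sym by blast+
  have neq: "a \<noteq> b" "a \<noteq> u" "b \<noteq> u" "a \<noteq> p" "b \<noteq> q" "u \<noteq> s" using abu c irr by blast+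
  have "distinct ?L" using far' neq c(7-9) by auto
  then have "inj_on ((!) ?L) {0..5}"
    by (intro inj_on_nth) auto
  moreover have set: "{0..5::nat} = {0, 1, 2, 3, 4, 5}" by auto
  have "\<forall>i\<in>{0..5}. \<forall>j\<in>{0..5}. E (?L ! i) (?L ! j) \<longleftrightarrow> WK3 i j"
    unfolding set WK3_iff using abu near far' c irr by simp
  ultimately show ?thesis unfolding has_induced_def by blast
qed

text \<open>Each vertex of the triangle is adjacent to at most one center, so three centers would be
  attached to three different vertices and give a whiskered triangle.\<close>

lemma WK3_free_near_triangle:
  fixes E :: "'v::finite \<Rightarrow> 'v \<Rightarrow> bool"
  assumes E: "simple_graph E" and C: "star_packing E C" and free: "WK3_free E"
    and abu: "E a b" "E a u" "E b u"
  shows "card {c \<in> C. E c a \<or> E c b \<or> E c u} \<le> 2"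
proof (rule ccontr)
  assume more: "\<not> card {c \<in> C. E c a \<or> E c b \<or> E c u} \<le> 2"
  let ?N = "\<lambda>x. {c \<in> C. E c x}"
  have le: "card (?N x) \<le> 1" for x by (rule star_packing_near[OF C])
  have *: "card (X \<union> Y) \<le> 2" if "card X \<le> 1" "card Y \<le> 1" for X Y :: "'v set"
    using card_Un_le[of X Y] that by linarith
  have "card (?N x \<union> ?N y) \<le> 2" for x y by (intro * le)
  then have not: "\<not> {c \<in> C. E c a \<or> E c b \<or> E c u} \<subseteq> ?N x \<union> ?N y" for x y
    using more card_mono[of "?N x \<union> ?N y" "{c \<in> C. E c a \<or> E c b \<or> E c u}"]
    by (meson finite_code le_trans)
  from not[of b u] obtain p where p: "p \<in> C" "E p a" "\<not> E p b" "\<not> E p u" by blast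
  from not[of a u] obtain q where q: "q \<in> C" "E q b" "\<not> E q a" "\<not> E q u" by blast
  from not[of a b] obtain s where s: "s \<in> C" "E s u" "\<not> E s a" "\<not> E s b" by blast
  have "has_induced E {0..5} WK3"
    by (rule has_induced_WK3[OF E C abu p(1) q(1) s(1) p(2) q(2) s(2)]) (use p q s in auto)
  then show False using free by (simp add: WK3_free_def)
qed

lemma near_triangle:
  fixes E :: "'v::finite \<Rightarrow> 'v \<Rightarrow> bool"
  assumes C: "star_packing E C"
  shows "card {c \<in> C. E c a \<or> E c b \<or> E c u} \<le> 3"
proof -
  let ?N = "\<lambda>x. {c \<in> C. E c x}"
  have "{c \<in> C. E c a \<or> E c b \<or> E c u} = ?N a \<union> ?N b \<union> ?N u" by auto
  then show ?thesis
    using card_Un_le[of "?N a \<union> ?N b" "?N u"] card_Un_le[of "?N a" "?N b"]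
      star_packing_near[OF C, of a] star_packing_near[OF C, of b] star_packing_near[OF C, of u] by simp
qed

lemma triangle_free_no_triangle:
  assumes E: "simple_graph E" and "triangle_free E" and "E a b" "E a u" shows "\<not> E b u"
proof
  assume "E b u"
  have sym: "\<And>x y. E x y \<longleftrightarrow> E y x" and irr: "\<And>x. \<not> E x x"
    using E by (auto simp: simple_graph_def)
  have ne: "a \<noteq> b" "a \<noteq> u" "b \<noteq> u" using assms(3,4) \<open>E b u\<close> irr by blast+
  have "has_induced E {0,1,2} K3"
    unfolding has_induced_def
  proof (intro exI[of _ "(!) [a, b, u]"] conjI)
    show "inj_on ((!) [a, b, u]) {0, 1, 2}" by (intro inj_on_nth) (use ne in auto)
    show "\<forall>i\<in>{0, 1, 2}. \<forall>j\<in>{0, 1, 2}. E ([a, b, u] ! i) ([a, b, u] ! j) \<longleftrightarrow> K3 i j"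
      using assms(3,4) \<open>E b u\<close> irr sym[of b a] sym[of u a] sym[of u b] by (simp add: K3_def)
  qed
  then show False using assms(2) by (simp add: triangle_free_def)
qed

lemma star_packing_number_attained:
  fixes E :: "'v::finite \<Rightarrow> 'v \<Rightarrow> bool"
  shows "\<exists>C. star_packing E C \<and> card C = star_packing_number E"
proof -
  have "finite {card C | C. star_packing E C}"
    using finite_imageI[of "{C. star_packing E C}" card] by (simp add: setcompr_eq_image)
  moreover have "star_packing E {}" by (simp add: star_packing_def)
  ultimately have "star_packing_number E \<in> {card C | C. star_packing E C}"
    unfolding star_packing_number_def by (intro Max_in) blast+
  then show ?thesis by auto
qed

theorem theorem3p6:
  fixes E :: "'v::finite \<Rightarrow> 'v \<Rightarrow> bool"
  assumes "simple_graph E"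
  defines "I2 \<equiv> ideal_prod (edge_ideal E :: ('v, 'k::field) mpoly set) (edge_ideal E)"
  shows "depth I2 \<ge> enat (star_packing_number E) - 2 \<and>
         (WK3_free E \<longrightarrow> depth I2 \<ge> enat (star_packing_number E) - 1) \<and>
         (triangle_free E \<longrightarrow> depth I2 \<ge> enat (star_packing_number E))"
proof -
  obtain C where C: "star_packing E C" and card: "card C = star_packing_number E"
    using star_packing_number_attained by blast
  note depth = depth_sq_ge[OF assms(1) C, where 'k = 'k, folded I2_def, unfolded card]
  have "depth I2 \<ge> enat (star_packing_number E - 2)"
    using near_triangle[OF C] by (intro depth) (simp add: numeral_3_eq_3)
  moreover have "depth I2 \<ge> enat (star_packing_number E - 1)" if "WK3_free E"
    using WK3_free_near_triangle[OF assms(1) C that] by (intro depth) (simp add: numeral_2_eq_2)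
  \<comment> \<open>Without triangles the hypothesis on triangles is vacuous, so
    \<open>k = 0\<close> is allowed.\<close>
  moreover have "depth I2 \<ge> enat (star_packing_number E - 0)" if "triangle_free E"
    using triangle_free_no_triangle[OF assms(1) that] by (intro depth) blast
  \<comment> \<open>Both subtractions are truncated at zero.\<close>
  moreover have "enat n - 2 = enat (n - 2)" "enat n - 1 = enat (n - 1)" for n
    by (simp_all add: numeral_eq_enat one_enat_def)
  ultimately show ?thesis by simp
qed

end
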